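(* Let $\mathcal{G}$ be a class of graphs for which there is a polynomial $p$ such that every $G\in\mathcal{G}$ has at most $p(|V(G)|)$ minimal vertex separators. Then Vertex Separator Reconfiguration on graphs of $\mathcal{G}$ can be solved in polynomial time under TAR and under TJ.
   Context: A minimal vertex separator of $G$ is a set that is a minimal $xy$-separator for some pair of distinct non-adjacent vertices $x,y$, where an $xy$-separator is $S\subseteq V(G)\setminus\{x,y\}$ with $x,y$ in different components of $G-S$, minimal if no proper subset is one. Vertex Separator Reconfiguration: given $G$, non-adjacent $s,t$, $st$-separators $S_a,S_b$ (for TAR also $k$ with $|S_a|,|S_b|\le k$; for TJ $|S_a|=|S_b|$), decide whether a sequence of $st$-separators from $S_a$ to $S_b$ exists with consecutive sets adjacent: TJ: $|S|=|S'|$, $|S\setminus S'|=|S'\setminus S|=1$; $k$-TAR: $|S\triangle S'|=1$, $\max(|S|,|S'|)\le k$. *)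

theory Defs
  imports
    "Graph_Theory.Digraph_Component"
    "HOL-Computational_Algebra.Polynomial"
begin

section \<open>Graphs and vertex separators\<close>

text \<open>
  A finite simple undirected graph is a \<^locale>\<open>pair_graph\<close>: a finite, loop-free digraph whose arc
  relation is symmetric. Strong components of a symmetric digraph are its connected components.
\<close>

definition del_verts :: "'a pair_pre_digraph \<Rightarrow> 'a set \<Rightarrow> ('a, 'a \<times> 'a) pre_digraph" where
  "del_verts G S = with_proj G \<restriction> (pverts G - S)"

definition components :: "('a, 'b) pre_digraph \<Rightarrow> 'a set set" where
  "components H = pre_digraph.sccs_verts H"

definition separator :: "'a pair_pre_digraph \<Rightarrow> 'a \<Rightarrow> 'a \<Rightarrow> 'a set \<Rightarrow> bool" where
  "separator G x y S \<longleftrightarrow>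
     S \<subseteq> pverts G - {x, y} \<and>
     (\<exists>C \<in> components (del_verts G S). \<exists>D \<in> components (del_verts G S).
        x \<in> C \<and> y \<in> D \<and> C \<noteq> D)"

definition minimal_separator :: "'a pair_pre_digraph \<Rightarrow> 'a \<Rightarrow> 'a \<Rightarrow> 'a set \<Rightarrow> bool" where
  "minimal_separator G x y S \<longleftrightarrow> separator G x y S \<and> (\<forall>S'. S' \<subset> S \<longrightarrow> \<not> separator G x y S')"

definition nonadjacent :: "'a pair_pre_digraph \<Rightarrow> 'a \<Rightarrow> 'a \<Rightarrow> bool" where
  "nonadjacent G x y \<longleftrightarrow> x \<in> pverts G \<and> y \<in> pverts G \<and> x \<noteq> y \<and> (x, y) \<notin> parcs G"

definition minimal_vertex_separators :: "'a pair_pre_digraph \<Rightarrow> 'a set set" where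
  "minimal_vertex_separators G = {S. \<exists>x y. nonadjacent G x y \<and> minimal_separator G x y S}"


section \<open>Vertex Separator Reconfiguration\<close>

definition tj_adjacent :: "'a set \<Rightarrow> 'a set \<Rightarrow> bool" where
  "tj_adjacent S S' \<longleftrightarrow> card S = card S' \<and> card (S - S') = 1 \<and> card (S' - S) = 1"

definition tar_adjacent :: "nat \<Rightarrow> 'a set \<Rightarrow> 'a set \<Rightarrow> bool" where
  "tar_adjacent k S S' \<longleftrightarrow> card (sym_diff S S') = 1 \<and> max (card S) (card S') \<le> k"

definition reconfigurable ::
  "('a set \<Rightarrow> 'a set \<Rightarrow> bool) \<Rightarrow> 'a pair_pre_digraph \<Rightarrow> 'a \<Rightarrow> 'a \<Rightarrow> 'a set \<Rightarrow> 'a set \<Rightarrow> bool"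
where
  "reconfigurable adj G s t A B \<longleftrightarrow>
     (\<exists>Ss. Ss \<noteq> [] \<and> hd Ss = A \<and> last Ss = B \<and>
           (\<forall>S \<in> set Ss. separator G s t S) \<and> successively adj Ss)"

type_synonym tj_instance = "nat pair_pre_digraph \<times> nat \<times> nat \<times> nat set \<times> nat set"
type_synonym tar_instance = "nat pair_pre_digraph \<times> nat \<times> nat \<times> nat set \<times> nat set \<times> nat"

definition tj_instances :: "nat pair_pre_digraph set \<Rightarrow> tj_instance set" where
  "tj_instances \<G> = {(G, s, t, A, B). G \<in> \<G> \<and> nonadjacent G s t \<and>
     separator G s t A \<and> separator G s t B \<and> card A = card B}"

definition tar_instances :: "nat pair_pre_digraph set \<Rightarrow> tar_instance set" where
  "tar_instances \<G> = {(G, s, t, A, B, k). G \<in> \<G> \<and> nonadjacent G s t \<and>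
     separator G s t A \<and> separator G s t B \<and> card A \<le> k \<and> card B \<le> k}"

fun tj_yes :: "tj_instance \<Rightarrow> bool" where
  "tj_yes (G, s, t, A, B) \<longleftrightarrow> reconfigurable tj_adjacent G s t A B"

fun tar_yes :: "tar_instance \<Rightarrow> bool" where
  "tar_yes (G, s, t, A, B, k) \<longleftrightarrow> reconfigurable (tar_adjacent k) G s t A B"


section \<open>Polynomial-time computation\<close>

text \<open>
  The machine model is first-order recursive programs over binary trees (pure Lisp with a single
  atom), cf. Jones, \<^emph>\<open>Computability and Complexity from a Programming Perspective\<close> (1997). Every
  step is a constant-time pointer operation: values may be shared, calls only need a control
  stack, and the only test is whether a value is the atom; in particular there is no primitive
  equality test on trees and no primitive arithmetic. Running times therefore agree with those of
  Turing machines up to a polynomial.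
\<close>

datatype data = Atom | Pair data data

fun left :: "data \<Rightarrow> data" where
  "left Atom = Atom"
| "left (Pair a b) = a"

fun right :: "data \<Rightarrow> data" where
  "right Atom = Atom"
| "right (Pair a b) = b"

text \<open>
  Variables are de Bruijn indices into the list of local values. A program is a finite list of
  bodies of unary functions, and \<open>Call f e\<close> calls the function at position \<open>f\<close>.
\<close>

datatype expr =
    Var nat
  | Const_Atom
  | Mk_Pair expr expr
  | Left expr
  | Right expr
  | If_Atom expr expr expr
  | Bind expr expr
  | Call nat expr

type_synonym program = "expr list"

text \<open>\<open>eval P env e v n\<close>: expression \<open>e\<close> evaluates to \<open>v\<close> in exactly \<open>n\<close> steps.\<close>

inductive eval :: "program \<Rightarrow> data list \<Rightarrow> expr \<Rightarrow> data \<Rightarrow> nat \<Rightarrow> bool" for P :: program where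
  eval_Var: "i < length env \<Longrightarrow> eval P env (Var i) (env ! i) 1"
| eval_Const_Atom: "eval P env Const_Atom Atom 1"
| eval_Mk_Pair: "eval P env e1 v1 n1 \<Longrightarrow> eval P env e2 v2 n2 \<Longrightarrow>
    eval P env (Mk_Pair e1 e2) (Pair v1 v2) (n1 + n2 + 1)"
| eval_Left: "eval P env e v n \<Longrightarrow> eval P env (Left e) (left v) (n + 1)"
| eval_Right: "eval P env e v n \<Longrightarrow> eval P env (Right e) (right v) (n + 1)"
| eval_If_Atom: "eval P env e Atom n \<Longrightarrow> eval P env e1 v m \<Longrightarrow>
    eval P env (If_Atom e e1 e2) v (n + m + 1)"
| eval_If_Pair: "eval P env e (Pair a b) n \<Longrightarrow> eval P env e2 v m \<Longrightarrow>
    eval P env (If_Atom e e1 e2) v (n + m + 1)"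
| eval_Bind: "eval P env e1 w n \<Longrightarrow> eval P (w # env) e2 v m \<Longrightarrow>
    eval P env (Bind e1 e2) v (n + m + 1)"
| eval_Call: "eval P env e w n \<Longrightarrow> f < length P \<Longrightarrow> eval P [w] (P ! f) v m \<Longrightarrow>
    eval P env (Call f e) v (n + m + 1)"

inductive_cases eval_VarE: "eval P env (Var i) v n"
inductive_cases eval_Const_AtomE: "eval P env Const_Atom v n"
inductive_cases eval_Mk_PairE: "eval P env (Mk_Pair e1 e2) v n"
inductive_cases eval_LeftE: "eval P env (Left e) v n"
inductive_cases eval_RightE: "eval P env (Right e) v n"
inductive_cases eval_If_AtomE: "eval P env (If_Atom e e1 e2) v n"
inductive_cases eval_BindE: "eval P env (Bind e1 e2) v n"
inductive_cases eval_CallE: "eval P env (Call f e) v n"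

lemma eval_deterministic:
  "eval P env e v n \<Longrightarrow> eval P env e v' n' \<Longrightarrow> v' = v \<and> n' = n"
proof (induction arbitrary: v' n' rule: eval.induct)
  case eval_Var then show ?case by (auto elim: eval_VarE)
next
  case eval_Const_Atom then show ?case by (auto elim: eval_Const_AtomE)
next
  case eval_Mk_Pair from eval_Mk_Pair.prems show ?case
    by (auto elim!: eval_Mk_PairE dest!: eval_Mk_Pair.IH)
next
  case eval_Left from eval_Left.prems show ?case
    by (auto elim!: eval_LeftE dest!: eval_Left.IH)
next
  case eval_Right from eval_Right.prems show ?case
    by (auto elim!: eval_RightE dest!: eval_Right.IH)
next
  case eval_If_Atom from eval_If_Atom.prems show ?case
    by (auto elim!: eval_If_AtomE dest!: eval_If_Atom.IH)
next
  case eval_If_Pair from eval_If_Pair.prems show ?case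
    by (auto elim!: eval_If_AtomE dest!: eval_If_Pair.IH)
next
  case eval_Bind from eval_Bind.prems show ?case
    by (auto elim!: eval_BindE dest!: eval_Bind.IH)
next
  case eval_Call from eval_Call.prems show ?case
    by (auto elim!: eval_CallE dest!: eval_Call.IH)
qed

text \<open>
  A decision problem consists of a set \<open>I\<close> of legal instances, a relation \<open>enc\<close> between instances
  and their encodings, and the predicate \<open>yes\<close> to be decided. An instance may have several
  encodings; the program must be correct and fast on each of them. Nothing is required on
  inputs that encode no legal instance. The program is started in its function number 0 and
  rejects by returning the atom; \<open>size\<close> counts the inner nodes of the input tree.
\<close>

definition poly_time_solvable :: "'i set \<Rightarrow> ('i \<Rightarrow> data \<Rightarrow> bool) \<Rightarrow> ('i \<Rightarrow> bool) \<Rightarrow> bool" where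
  "poly_time_solvable I enc yes \<longleftrightarrow>
     (\<exists>(P :: program) (q :: nat poly). \<forall>i \<in> I. \<forall>d. enc i d \<longrightarrow>
        (\<exists>v n. eval P [d] (Call 0 (Var 0)) v n \<and> n \<le> poly q (size d) \<and> (v \<noteq> Atom \<longleftrightarrow> yes i)))"


section \<open>Encoding of instances\<close>

text \<open>Numbers are encoded in binary, least significant bit first.\<close>

fun enc_nat :: "nat \<Rightarrow> data" where
  "enc_nat n = (if n = 0 then Atom
     else Pair (if odd n then Pair Atom Atom else Atom) (enc_nat (n div 2)))"

declare enc_nat.simps [simp del]

definition enc_arc :: "nat \<times> nat \<Rightarrow> data" where
  "enc_arc a = Pair (enc_nat (fst a)) (enc_nat (snd a))"

definition enc_list :: "('a \<Rightarrow> data) \<Rightarrow> 'a list \<Rightarrow> data" where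
  "enc_list f xs = foldr (\<lambda>x d. Pair (f x) d) xs Atom"

definition encodes_set :: "('a \<Rightarrow> data) \<Rightarrow> 'a set \<Rightarrow> data \<Rightarrow> bool" where
  "encodes_set f A d \<longleftrightarrow> (\<exists>xs. distinct xs \<and> set xs = A \<and> d = enc_list f xs)"

definition encodes_graph :: "nat pair_pre_digraph \<Rightarrow> data \<Rightarrow> bool" where
  "encodes_graph G d \<longleftrightarrow>
     (\<exists>v a. encodes_set enc_nat (pverts G) v \<and> encodes_set enc_arc (parcs G) a \<and> d = Pair v a)"

fun encodes_tj :: "tj_instance \<Rightarrow> data \<Rightarrow> bool" where
  "encodes_tj (G, s, t, A, B) d \<longleftrightarrow>
     (\<exists>g a b. encodes_graph G g \<and> encodes_set enc_nat A a \<and> encodes_set enc_nat B b \<and>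
        d = Pair g (Pair (enc_nat s) (Pair (enc_nat t) (Pair a b))))"

fun encodes_tar :: "tar_instance \<Rightarrow> data \<Rightarrow> bool" where
  "encodes_tar (G, s, t, A, B, k) d \<longleftrightarrow>
     (\<exists>d'. encodes_tj (G, s, t, A, B) d' \<and> d = Pair (enc_nat k) d')"

end

theory Submission
  imports Defs
begin

text \<open>
  Write \<open>C_t(S)\<close> for the component of \<open>t\<close> in \<open>G - S\<close>. If \<open>S\<close> is a minimal \<open>st\<close>-separator and
  \<open>x \<in> S\<close> is not adjacent to \<open>t\<close>, then the neighbourhood of the component of \<open>t\<close> in
  \<open>G - (S \<union> N(x))\<close> is again a minimal \<open>st\<close>-separator, with a strictly smaller \<open>C_t\<close>. Starting from
  the neighbourhood of the component of \<open>t\<close> in \<open>G - N(s)\<close>, every minimal \<open>st\<close>-separator is reached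
  after at most \<open>|V(G)|\<close> such steps, and only minimal separators occur on the way; hence
  \<open>|V(G)|\<close> rounds of closing a duplicate-free list under these steps enumerate all of them in
  polynomial time.

  Every set in a reconfiguration sequence contains a minimal separator, and two consecutive sets
  of a \<open>k\<close>-TAR sequence have a union of size at most \<open>k\<close> (at most \<open>k + 1\<close> for a TJ sequence of
  \<open>k\<close>-sets). Conversely one can move between supersets of \<open>X\<close> and \<open>Y\<close> as soon as \<open>X \<union> Y\<close> is that
  small. So it suffices to decide connectivity in the graph whose vertices are \<open>S_a\<close>, \<open>S_b\<close> and the
  minimal separators of size at most \<open>k\<close>, joined if their union is small enough.

  Polynomial running times come from closure properties: functions computable within polynomial
  time and output size are closed under loops whose intermediate values stay polynomially bounded,
  hence under list comprehension, bounded quantification and bounded iteration, and the algorithm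
  uses nothing else.
\<close>


section \<open>Polynomial-time functions on binary trees\<close>

subsection \<open>Linking programs\<close>

lemma eval_append_env: "eval P env e v n \<Longrightarrow> eval P (env @ env') e v n"
proof (induction rule: eval.induct)
  case (eval_Var i env)
  then show ?case
    using eval.eval_Var[of i "env @ env'" P] by (simp add: nth_append)
next
  case (eval_Bind env e1 w n e2 v m)
  then show ?case by (intro eval.eval_Bind) auto
next
  case (eval_Call env e w n f v m)
  then show ?case by (intro eval.eval_Call) auto
qed (blast intro: eval.intros)+

lemma eval_append_program: "eval P env e v n \<Longrightarrow> eval (P @ Q) env e v n"
proof (induction rule: eval.induct)
  case (eval_Call env e w n f v m)
  then show ?case
    by (intro eval.eval_Call[where w = w]) (auto simp: nth_append)
qed (blast intro: eval.intros)+

primrec shift_calls :: "nat \<Rightarrow> expr \<Rightarrow> expr" where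
  "shift_calls k (Var i) = Var i"
| "shift_calls k Const_Atom = Const_Atom"
| "shift_calls k (Mk_Pair e1 e2) = Mk_Pair (shift_calls k e1) (shift_calls k e2)"
| "shift_calls k (Left e) = Left (shift_calls k e)"
| "shift_calls k (Right e) = Right (shift_calls k e)"
| "shift_calls k (If_Atom e e1 e2) =
     If_Atom (shift_calls k e) (shift_calls k e1) (shift_calls k e2)"
| "shift_calls k (Bind e1 e2) = Bind (shift_calls k e1) (shift_calls k e2)"
| "shift_calls k (Call f e) = Call (k + f) (shift_calls k e)"

lemma eval_shift_calls:
  "eval P env e v n \<Longrightarrow>
   eval (Q @ map (shift_calls (length Q)) P) env (shift_calls (length Q) e) v n"
proof (induction rule: eval.induct)
  case (eval_Call env e w n f v m)
  then show ?case
    unfolding shift_calls.simps by (intro eval.eval_Call[where w = w]) (auto simp: nth_append)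
qed (unfold shift_calls.simps, (blast intro: eval.intros)+)


subsection \<open>Evaluation within a time bound\<close>

definition eval_within :: "program \<Rightarrow> data list \<Rightarrow> expr \<Rightarrow> data \<Rightarrow> nat \<Rightarrow> bool" where
  "eval_within P env e v T \<longleftrightarrow> (\<exists>n \<le> T. eval P env e v n)"

lemma eval_withinI: "eval P env e v n \<Longrightarrow> n \<le> T \<Longrightarrow> eval_within P env e v T"
  by (auto simp: eval_within_def)

lemma eval_within_mono: "eval_within P env e v T \<Longrightarrow> T \<le> T' \<Longrightarrow> eval_within P env e v T'"
  by (meson eval_within_def order_trans)

lemma eval_within_Var: "i < length env \<Longrightarrow> env ! i = v \<Longrightarrow> eval_within P env (Var i) v 1"
  using eval_Var eval_withinI by blast

lemma eval_within_Mk_Pair: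
  "eval_within P env e1 v1 T1 \<Longrightarrow> eval_within P env e2 v2 T2 \<Longrightarrow>
   eval_within P env (Mk_Pair e1 e2) (Pair v1 v2) (T1 + T2 + 1)"
  unfolding eval_within_def by (meson add_mono eval_Mk_Pair order_refl)

lemma eval_within_Left: "eval_within P env e v T \<Longrightarrow> eval_within P env (Left e) (left v) (T + 1)"
  unfolding eval_within_def by (meson add_mono eval_Left order_refl)

lemma eval_within_Right: "eval_within P env e v T \<Longrightarrow> eval_within P env (Right e) (right v) (T + 1)"
  unfolding eval_within_def by (meson add_mono eval_Right order_refl)

lemma eval_within_If_Atom:
  assumes "eval_within P env e w T"
    and "w = Atom \<Longrightarrow> eval_within P env e1 v T'" and "w \<noteq> Atom \<Longrightarrow> eval_within P env e2 v T'"
  shows "eval_within P env (If_Atom e e1 e2) v (T + T' + 1)"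
proof (cases w)
  case Atom
  with assms show ?thesis
    unfolding eval_within_def by (meson add_mono eval_If_Atom order_refl)
next
  case (Pair a b)
  with assms show ?thesis
    unfolding eval_within_def by (metis add_mono data.distinct(1) eval_If_Pair order_refl)
qed

lemma eval_within_Bind:
  "eval_within P env e1 w T1 \<Longrightarrow> eval_within P [w] e2 v T2 \<Longrightarrow>
   eval_within P env (Bind e1 e2) v (T1 + T2 + 1)"
  unfolding eval_within_def
  using eval_append_env[of P "[w]" e2 v _ env, unfolded append.simps]
  by (meson add_mono eval_Bind order_refl)

lemma eval_within_Call:
  "eval_within P env e w T1 \<Longrightarrow> f < length P \<Longrightarrow> eval_within P [w] (P ! f) v T2 \<Longrightarrow>
   eval_within P env (Call f e) v (T1 + T2 + 1)"
  unfolding eval_within_def by (meson add_mono eval_Call order_refl)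

lemma eval_within_append_program:
  "eval_within P env e v T \<Longrightarrow> eval_within (P @ Q) env e v T"
  unfolding eval_within_def using eval_append_program by blast

lemma eval_within_shift_calls:
  "eval_within P env e v T \<Longrightarrow>
   eval_within (Q @ map (shift_calls (length Q)) P) env (shift_calls (length Q) e) v T"
  unfolding eval_within_def using eval_shift_calls by blast


subsection \<open>Polynomial bounds\<close>

definition poly_bounded :: "data set \<Rightarrow> (data \<Rightarrow> nat) \<Rightarrow> bool" where
  "poly_bounded D g \<longleftrightarrow> (\<exists>q. \<forall>d \<in> D. g d \<le> poly q (size d))"

lemma poly_boundedI: "(\<And>d. d \<in> D \<Longrightarrow> g d \<le> poly q (size d)) \<Longrightarrow> poly_bounded D g"
  by (auto simp: poly_bounded_def)

lemma poly_boundedE: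
  assumes "poly_bounded D g"
  obtains q where "\<And>d. d \<in> D \<Longrightarrow> g d \<le> poly q (size d)"
  using assms by (auto simp: poly_bounded_def)

lemma poly_bounded_mono:
  assumes "poly_bounded D h" and "\<And>d. d \<in> D \<Longrightarrow> g d \<le> h d"
  shows "poly_bounded D g"
  using assms unfolding poly_bounded_def by (meson order_trans)

lemma poly_bounded_const: "poly_bounded D (\<lambda>_. k)"
  by (rule poly_boundedI[of _ _ "[:k:]"]) simp

lemma poly_bounded_size: "poly_bounded D size"
  by (rule poly_boundedI[of _ _ "[:0, 1:]"]) simp

lemma poly_bounded_add:
  assumes "poly_bounded D g" "poly_bounded D h"
  shows "poly_bounded D (\<lambda>d. g d + h d)"
proof -
  obtain q r where "\<And>d. d \<in> D \<Longrightarrow> g d \<le> poly q (size d)" "\<And>d. d \<in> D \<Longrightarrow> h d \<le> poly r (size d)"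
    using assms by (metis poly_boundedE)
  then show ?thesis by (intro poly_boundedI[of _ _ "q + r"]) (simp add: add_mono)
qed

lemma poly_bounded_mult:
  assumes "poly_bounded D g" "poly_bounded D h"
  shows "poly_bounded D (\<lambda>d. g d * h d)"
proof -
  obtain q r where "\<And>d. d \<in> D \<Longrightarrow> g d \<le> poly q (size d)" "\<And>d. d \<in> D \<Longrightarrow> h d \<le> poly r (size d)"
    using assms by (metis poly_boundedE)
  then show ?thesis by (intro poly_boundedI[of _ _ "q * r"]) (simp add: mult_mono)
qed

lemma poly_bounded_poly: "poly_bounded D g \<Longrightarrow> poly_bounded D (\<lambda>d. poly q (g d))"
  by (induction q) (simp_all add: poly_bounded_const poly_bounded_add poly_bounded_mult)

lemma poly_nat_mono: "m \<le> n \<Longrightarrow> poly q m \<le> poly q n" for q :: "nat poly"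
  by (induction q) (auto intro: add_mono mult_mono)

lemma poly_bounded_compose:
  assumes "poly_bounded D' g" "poly_bounded D (\<lambda>d. size (f d))" "f ` D \<subseteq> D'"
  shows "poly_bounded D (\<lambda>d. g (f d))"
proof -
  obtain q where "\<And>d. d \<in> D' \<Longrightarrow> g d \<le> poly q (size d)"
    using assms(1) by (metis poly_boundedE)
  then show ?thesis
    using assms(3) by (intro poly_bounded_mono[OF poly_bounded_poly[OF assms(2), of q]]) blast
qed

lemmas poly_bounded_intros =
  poly_bounded_const poly_bounded_size poly_bounded_add poly_bounded_mult


subsection \<open>Polynomial-time functions\<close>

text \<open>
  Because values are shared, a value computed in polynomially many steps may have exponential
  size; the size bound is therefore a separate requirement.
\<close>

definition ptime :: "data set \<Rightarrow> (data \<Rightarrow> data) \<Rightarrow> bool" where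
  "ptime D f \<longleftrightarrow> poly_bounded D (\<lambda>d. size (f d)) \<and>
     (\<exists>P e T. poly_bounded D T \<and> (\<forall>d \<in> D. eval_within P [d] e (f d) (T d)))"

lemma ptimeI:
  assumes "poly_bounded D (\<lambda>d. size (f d))" "poly_bounded D T"
    and "\<And>d. d \<in> D \<Longrightarrow> eval_within P [d] e (f d) (T d)"
  shows "ptime D f"
  using assms unfolding ptime_def by blast

lemma ptimeE:
  assumes "ptime D f"
  obtains P e T where "poly_bounded D T" "\<And>d. d \<in> D \<Longrightarrow> eval_within P [d] e (f d) (T d)"
  using assms unfolding ptime_def by blast

lemma poly_bounded_ptime: "ptime D f \<Longrightarrow> poly_bounded D (\<lambda>d. size (f d))"
  unfolding ptime_def by blast

lemma ptime_cong: "ptime D f \<Longrightarrow> (\<And>d. d \<in> D \<Longrightarrow> f d = g d) \<Longrightarrow> ptime D g"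
  unfolding ptime_def poly_bounded_def by auto

lemma ptime_linkedE:
  assumes "ptime D f" "ptime D' g"
  obtains P e1 e2 T1 T2 where
    "poly_bounded D T1" "\<And>d. d \<in> D \<Longrightarrow> eval_within P [d] e1 (f d) (T1 d)"
    "poly_bounded D' T2" "\<And>d. d \<in> D' \<Longrightarrow> eval_within P [d] e2 (g d) (T2 d)"
proof -
  obtain P1 e1 T1 where f: "poly_bounded D T1" "\<And>d. d \<in> D \<Longrightarrow> eval_within P1 [d] e1 (f d) (T1 d)"
    using assms(1) by (metis ptimeE)
  obtain P2 e2 T2 where g: "poly_bounded D' T2" "\<And>d. d \<in> D' \<Longrightarrow> eval_within P2 [d] e2 (g d) (T2 d)"
    using assms(2) by (metis ptimeE)
  show thesis
    by (rule that[OF f(1) eval_within_append_program[OF f(2)]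
          g(1) eval_within_shift_calls[OF g(2)]])
qed

lemma ptime_id: "ptime D (\<lambda>d. d)"
  by (rule ptimeI[of _ _ "\<lambda>_. 1" "[]" "Var 0"]; intro poly_bounded_intros eval_within_Var) auto

lemma ptime_Atom: "ptime D (\<lambda>_. Atom)"
  by (rule ptimeI[of _ _ "\<lambda>_. 1" "[]" Const_Atom])
    (auto intro: poly_bounded_intros eval_withinI eval_Const_Atom)

lemma ptime_Pair:
  assumes "ptime D f" and "ptime D g"
  shows "ptime D (\<lambda>d. Pair (f d) (g d))"
proof -
  obtain P e1 e2 T1 T2 where
    "poly_bounded D T1" "\<And>d. d \<in> D \<Longrightarrow> eval_within P [d] e1 (f d) (T1 d)"
    "poly_bounded D T2" "\<And>d. d \<in> D \<Longrightarrow> eval_within P [d] e2 (g d) (T2 d)"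
    using ptime_linkedE[OF assms] by metis
  then show ?thesis
    by (intro ptimeI[of _ _ "\<lambda>d. T1 d + T2 d + 1" P "Mk_Pair e1 e2"] eval_within_Mk_Pair)
      (auto intro!: poly_bounded_intros poly_bounded_ptime assms simp only: data.size)
qed

lemma ptime_compose:
  assumes f: "ptime D f" and g: "ptime D' g" and image: "f ` D \<subseteq> D'"
  shows "ptime D (\<lambda>d. g (f d))"
proof -
  obtain P e1 e2 T1 T2 where linked:
    "poly_bounded D T1" "\<And>d. d \<in> D \<Longrightarrow> eval_within P [d] e1 (f d) (T1 d)"
    "poly_bounded D' T2" "\<And>d. d \<in> D' \<Longrightarrow> eval_within P [d] e2 (g d) (T2 d)"
    using ptime_linkedE[OF f g] by metis
  show ?thesis
  proof (rule ptimeI)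
    show "poly_bounded D (\<lambda>d. size (g (f d)))"
      by (rule poly_bounded_compose[OF poly_bounded_ptime[OF g] poly_bounded_ptime[OF f] image])
    show "poly_bounded D (\<lambda>d. T1 d + T2 (f d) + 1)"
      by (intro poly_bounded_intros linked
          poly_bounded_compose[OF _ poly_bounded_ptime[OF f] image])
    show "eval_within P [d] (Bind e1 e2) (g (f d)) (T1 d + T2 (f d) + 1)" if "d \<in> D" for d
      using that linked image by (intro eval_within_Bind) auto
  qed
qed

lemma size_left_le: "size (left d) \<le> size d" and size_right_le: "size (right d) \<le> size d"
  by (cases d; simp)+

lemma ptime_left: "ptime D f \<Longrightarrow> ptime D (\<lambda>d. left (f d))"
proof (erule ptime_compose[OF _ _ subset_UNIV])
  show "ptime UNIV left"
    by (rule ptimeI[of _ _ "\<lambda>_. 2" "[]" "Left (Var 0)"])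
      (auto intro!: poly_bounded_intros poly_bounded_mono[OF poly_bounded_size] size_left_le
        eval_within_mono[OF eval_within_Left[OF eval_within_Var]])
qed

lemma ptime_right: "ptime D f \<Longrightarrow> ptime D (\<lambda>d. right (f d))"
proof (erule ptime_compose[OF _ _ subset_UNIV])
  show "ptime UNIV right"
    by (rule ptimeI[of _ _ "\<lambda>_. 2" "[]" "Right (Var 0)"])
      (auto intro!: poly_bounded_intros poly_bounded_mono[OF poly_bounded_size] size_right_le
        eval_within_mono[OF eval_within_Right[OF eval_within_Var]])
qed

lemma ptime_if_Atom:
  assumes "ptime D f" "ptime D g" "ptime D h"
  shows "ptime D (\<lambda>d. if f d = Atom then g d else h d)"
proof -
  define select where "select d = (if left d = Atom then left (right d) else right (right d))" for d
  have "ptime UNIV select"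
  proof (rule ptimeI)
    show "poly_bounded UNIV (\<lambda>d. size (select d))"
      by (rule poly_bounded_mono[OF poly_bounded_size])
        (auto simp: select_def intro: size_left_le size_right_le order_trans)
    show "poly_bounded UNIV (\<lambda>_. 6)" by (rule poly_bounded_const)
    show "eval_within [] [d] (If_Atom (Left (Var 0)) (Left (Right (Var 0))) (Right (Right (Var 0))))
        (select d) 6" for d
    proof (rule eval_within_mono[OF eval_within_If_Atom])
      show "eval_within [] [d] (Left (Var 0)) (left d) 2"
        by (rule eval_within_mono[OF eval_within_Left[OF eval_within_Var]]) auto
      show "eval_within [] [d] (Left (Right (Var 0))) (select d) 3" if "left d = Atom"
        using that eval_within_mono[OF eval_within_Left[OF eval_within_Right[OF eval_within_Var]]]
        by (simp add: select_def)
      show "eval_within [] [d] (Right (Right (Var 0))) (select d) 3" if "left d \<noteq> Atom"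
        using that eval_within_mono[OF eval_within_Right[OF eval_within_Right[OF eval_within_Var]]]
        by (simp add: select_def)
    qed simp
  qed
  from ptime_compose[OF ptime_Pair[OF assms(1) ptime_Pair[OF assms(2,3)]] this subset_UNIV]
  show ?thesis by (simp add: select_def cong: if_cong)
qed

lemma poly_time_solvableI:
  assumes "ptime {d. \<exists>i \<in> I. enc i d} f"
    and yes: "\<And>i d. i \<in> I \<Longrightarrow> enc i d \<Longrightarrow> f d \<noteq> Atom \<longleftrightarrow> yes i"
  shows "poly_time_solvable I enc yes"
proof -
  let ?D = "{d. \<exists>i \<in> I. enc i d}"
  obtain P e T where T: "poly_bounded ?D T" "\<And>d. d \<in> ?D \<Longrightarrow> eval_within P [d] e (f d) (T d)"
    using assms(1) unfolding ptime_def by blast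
  have "poly_bounded ?D (\<lambda>d. 1 + T d + 1)" by (intro poly_bounded_intros T)
  then obtain q where q: "\<And>d. d \<in> ?D \<Longrightarrow> 1 + T d + 1 \<le> poly q (size d)"
    unfolding poly_bounded_def by blast
  define Q where "Q = [shift_calls 1 e] @ map (shift_calls 1) P"
  have "eval_within Q [d] (Call 0 (Var 0)) (f d) (poly q (size d))" if d: "d \<in> ?D" for d
  proof -
    have "eval_within Q [d] (Q ! 0) (f d) (T d)"
      using eval_within_shift_calls[OF T(2)[OF d], of "[shift_calls 1 e]"] by (simp add: Q_def)
    then have "eval_within Q [d] (Call 0 (Var 0)) (f d) (1 + T d + 1)"
      by (intro eval_within_Call[OF eval_within_Var]) (auto simp: Q_def)
    then show ?thesis using q[OF d] by (rule eval_within_mono)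
  qed
  with yes show ?thesis unfolding poly_time_solvable_def eval_within_def by blast
qed


subsection \<open>Loops\<close>

inductive loop_run :: "(data \<Rightarrow> data) \<Rightarrow> data set \<Rightarrow> nat \<Rightarrow> data \<Rightarrow> data \<Rightarrow> bool"
  for step :: "data \<Rightarrow> data" and Q :: "data set" where
  loop_stop: "s \<in> Q \<Longrightarrow> left s = Atom \<Longrightarrow> loop_run step Q 0 s s"
| loop_step: "s \<in> Q \<Longrightarrow> left s \<noteq> Atom \<Longrightarrow> loop_run step Q n (step s) v \<Longrightarrow>
    loop_run step Q (Suc n) s v"

lemma loop_run_final: "loop_run step Q n s v \<Longrightarrow> v \<in> Q"
  by (induction rule: loop_run.induct)

lemma eval_within_loop:
  assumes step: "\<And>s. s \<in> Q \<Longrightarrow> eval_within P [s] e (step s) T"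
    and loop: "f < length P" "P ! f = If_Atom (Left (Var 0)) (Var 0) (Call f e)"
    and run: "loop_run step Q n s v"
  shows "eval_within P [s] (P ! f) v ((n + 1) * (T + 4))"
  using run
proof (induction rule: loop_run.induct)
  case (loop_stop s)
  have "eval_within P [s] (P ! f) s (1 + 1 + 1 + 1)"
    unfolding loop(2) using loop_stop(2)
    by (intro eval_within_If_Atom[OF eval_within_Left[OF eval_within_Var]] eval_within_Var) auto
  then show ?case by (rule eval_within_mono) simp
next
  case (loop_step s n v)
  have "eval_within P [s] (P ! f) v (1 + 1 + (T + (n + 1) * (T + 4) + 1) + 1)"
    unfolding loop(2) using loop_step loop(2)
    by (intro eval_within_If_Atom[OF eval_within_Left[OF eval_within_Var]]
        eval_within_Call[OF step loop(1)]) auto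
  then show ?case by (rule eval_within_mono) simp
qed

lemma ptime_loop:
  assumes step: "ptime D' step" and init: "ptime D g"
    and N: "poly_bounded D N" and M: "poly_bounded D M"
    and run: "\<And>d. d \<in> D \<Longrightarrow> \<exists>n \<le> N d. loop_run step {s \<in> D'. size s \<le> M d} n (g d) (f d)"
  shows "ptime D f"
proof -
  obtain P e0 e1 T0 T1 where
    init: "poly_bounded D T0" "\<And>d. d \<in> D \<Longrightarrow> eval_within P [d] e0 (g d) (T0 d)"
    and step: "poly_bounded D' T1" "\<And>s. s \<in> D' \<Longrightarrow> eval_within P [s] e1 (step s) (T1 s)"
    using ptime_linkedE[OF init step] by metis
  obtain q where q: "\<And>s. s \<in> D' \<Longrightarrow> T1 s \<le> poly q (size s)"
    using step(1) by (metis poly_boundedE)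
  define loop where "loop = If_Atom (Left (Var 0)) (Var 0) (Call (length P) e1)"
  define P' where "P' = P @ [loop]"
  show ?thesis
  proof (rule ptimeI)
    show "poly_bounded D (\<lambda>d. size (f d))"
      using run loop_run_final by (intro poly_bounded_mono[OF M]) blast
    show "poly_bounded D (\<lambda>d. T0 d + (N d + 1) * (poly q (M d) + 4) + 1)"
      by (intro poly_bounded_intros poly_bounded_poly init N M)
    fix d assume d: "d \<in> D"
    then obtain n where n: "n \<le> N d" "loop_run step {s \<in> D'. size s \<le> M d} n (g d) (f d)"
      using run by blast
    have "eval_within P' [s] e1 (step s) (poly q (M d))" if "s \<in> D'" "size s \<le> M d" for s
      using eval_within_append_program[OF step(2)[OF that(1)]] q[OF that(1)]
        poly_nat_mono[OF that(2), of q] by (auto simp: P'_def intro: eval_within_mono)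
    then have "eval_within P' [g d] (P' ! length P) (f d) ((n + 1) * (poly q (M d) + 4))"
      by (intro eval_within_loop[OF _ _ _ n(2)]) (auto simp: P'_def loop_def)
    then have "eval_within P' [g d] (P' ! length P) (f d) ((N d + 1) * (poly q (M d) + 4))"
      by (rule eval_within_mono) (intro mult_le_mono1 add_le_mono1 n(1))
    moreover have "eval_within P' [d] e0 (g d) (T0 d)"
      unfolding P'_def by (rule eval_within_append_program[OF init(2)[OF d]])
    ultimately show "eval_within P' [d] (Call (length P) e0) (f d)
        (T0 d + (N d + 1) * (poly q (M d) + 4) + 1)"
      by (intro eval_within_Call) (auto simp: P'_def)
  qed
qed


subsection \<open>Lists, truth values and unary numbers as trees\<close>

primrec elems :: "data \<Rightarrow> data list" where
  "elems Atom = []"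
| "elems (Pair x xs) = x # elems xs"

abbreviation dset :: "data \<Rightarrow> data set" where
  "dset d \<equiv> set (elems d)"

abbreviation dlist :: "data list \<Rightarrow> data" where
  "dlist xs \<equiv> enc_list (\<lambda>x. x) xs"

definition dbool :: "bool \<Rightarrow> data" where
  "dbool b = (if b then Pair Atom Atom else Atom)"

definition unary :: "nat \<Rightarrow> data" where
  "unary n = dlist (replicate n Atom)"

abbreviation ptime_list :: "data set \<Rightarrow> (data \<Rightarrow> data list) \<Rightarrow> bool" where
  "ptime_list D f \<equiv> ptime D (\<lambda>d. dlist (f d))"

abbreviation ptime_pred :: "data set \<Rightarrow> (data \<Rightarrow> bool) \<Rightarrow> bool" where
  "ptime_pred D P \<equiv> ptime D (\<lambda>d. dbool (P d))"

abbreviation ptime_nat :: "data set \<Rightarrow> (data \<Rightarrow> nat) \<Rightarrow> bool" where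
  "ptime_nat D f \<equiv> ptime D (\<lambda>d. unary (f d))"

lemma enc_list_simps [simp]:
  "enc_list f [] = Atom" "enc_list f (x # xs) = Pair (f x) (enc_list f xs)"
  by (simp_all add: enc_list_def)

lemma elems_enc_list [simp]: "elems (enc_list f xs) = map f xs"
  by (induction xs) auto

lemma elems_dlist: "elems (dlist xs) = xs"
  by simp

lemma dlist_elems [simp]: "dlist (elems d) = d"
  by (induction d) auto

lemma size_dlist: "size (dlist xs) = (\<Sum>x\<leftarrow>xs. size x + 1)"
  by (induction xs) auto

lemma size_dlist_append [simp]: "size (dlist (xs @ ys)) = size (dlist xs) + size (dlist ys)"
  by (simp add: size_dlist)

lemma length_le_size_dlist: "length xs \<le> size (dlist xs)"
  by (induction xs) auto

lemma size_le_size_dlist: "x \<in> set xs \<Longrightarrow> size x \<le> size (dlist xs)"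
  by (induction xs) auto

lemma size_dlist_filter_le: "size (dlist (filter P xs)) \<le> size (dlist xs)"
  by (induction xs) auto

lemma size_dlist_le:
  assumes "\<And>x. x \<in> set xs \<Longrightarrow> size x \<le> m"
  shows "size (dlist xs) \<le> length xs * (m + 1)"
  unfolding size_dlist using sum_list_mono[of xs "\<lambda>x. size x + 1" "\<lambda>_. m + 1"] assms
  by (simp add: sum_list_triv)

lemma dbool_eq_Atom [simp]: "dbool b = Atom \<longleftrightarrow> \<not> b"
  by (simp add: dbool_def)

lemma unary_simps [simp]: "unary 0 = Atom" "unary (Suc n) = Pair Atom (unary n)"
  by (simp_all add: unary_def)

lemma size_unary [simp]: "size (unary n) = n"
  by (induction n) auto

lemma length_elems_unary: "length (elems (unary n)) = n"
  by (simp add: unary_def)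


subsection \<open>Conditionals, equality and Boolean connectives\<close>

lemma ptime_If:
  assumes "ptime_pred D P" "ptime D f" "ptime D g"
  shows "ptime D (\<lambda>d. if P d then f d else g d)"
  by (rule ptime_cong[OF ptime_if_Atom[OF assms(1,3,2)]]) simp

lemma ptime_list_If:
  assumes "ptime_pred D P" "ptime_list D f" "ptime_list D g"
  shows "ptime_list D (\<lambda>d. if P d then f d else g d)"
  by (rule ptime_cong[OF ptime_If[OF assms]]) simp

lemma ptime_nat_If:
  assumes "ptime_pred D P" "ptime_nat D f" "ptime_nat D g"
  shows "ptime_nat D (\<lambda>d. if P d then f d else g d)"
  by (rule ptime_cong[OF ptime_If[OF assms]]) simp

lemma ptime_pred_True: "ptime_pred D (\<lambda>_. True)" and ptime_pred_False: "ptime_pred D (\<lambda>_. False)"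
  by (simp_all add: dbool_def ptime_Atom ptime_Pair)

lemma ptime_pred_not:
  assumes "ptime_pred D P"
  shows "ptime_pred D (\<lambda>d. \<not> P d)"
  by (rule ptime_cong[OF ptime_If[OF assms ptime_pred_False ptime_pred_True]]) simp

lemma ptime_pred_conj:
  assumes "ptime_pred D P" "ptime_pred D Q"
  shows "ptime_pred D (\<lambda>d. P d \<and> Q d)"
  by (rule ptime_cong[OF ptime_If[OF assms ptime_pred_False]]) simp

lemma ptime_pred_disj:
  assumes "ptime_pred D P" "ptime_pred D Q"
  shows "ptime_pred D (\<lambda>d. P d \<or> Q d)"
  by (rule ptime_cong[OF ptime_If[OF assms(1) ptime_pred_True assms(2)]]) simp

lemma ptime_pred_eq_Atom: "ptime D f \<Longrightarrow> ptime_pred D (\<lambda>d. f d = Atom)"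
  unfolding dbool_def by (intro ptime_if_Atom ptime_Pair ptime_Atom)

text \<open>
  Equality of trees is decided by a loop. Its state \<open>Pair st r\<close> consists of a stack \<open>st\<close> of pairs of
  trees still to be compared and the result \<open>r\<close> so far.
\<close>

definition eq_step :: "data \<Rightarrow> data" where
  "eq_step s = (let x = left (left (left s)); y = right (left (left s)); st = right (left s) in
     if x = Atom \<and> y = Atom then Pair st (right s)
     else if x = Atom \<or> y = Atom then Pair st Atom
     else Pair (Pair (Pair (left x) (left y)) (Pair (Pair (right x) (right y)) st)) (right s))"

lemma ptime_eq_step: "ptime D eq_step"
  unfolding eq_step_def Let_def
  by (intro ptime_If ptime_pred_conj ptime_pred_disj ptime_pred_eq_Atom ptime_Pair ptime_left
      ptime_right ptime_Atom ptime_id)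

definition eq_state :: "(data \<times> data) list \<Rightarrow> data \<Rightarrow> data" where
  "eq_state ps r = Pair (enc_list (\<lambda>(x, y). Pair x y) ps) r"

definition eq_result :: "(data \<times> data) list \<Rightarrow> data \<Rightarrow> data" where
  "eq_result ps r = (if \<forall>(x, y) \<in> set ps. x = y then r else Atom)"

definition eq_cost :: "(data \<times> data) list \<Rightarrow> nat" where
  "eq_cost ps = (\<Sum>(x, y)\<leftarrow>ps. 2 * size x + 1)"

lemma eq_step_eq_state:
  assumes "ps \<noteq> []"
  obtains ps' r' where "eq_step (eq_state ps r) = eq_state ps' r'"
    "size (eq_state ps' r') \<le> size (eq_state ps r)" "eq_cost ps' < eq_cost ps"
    "eq_result ps' r' = eq_result ps r"
proof -
  note eq_defs = eq_step_def eq_state_def eq_cost_def eq_result_def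
  obtain x y qs where ps: "ps = (x, y) # qs"
    using assms by (metis list.exhaust surj_pair)
  show thesis
  proof (cases "x = Atom \<or> y = Atom")
    case True
    then show thesis
      by (intro that[of qs "if x = y then r else Atom"]) (auto simp: ps eq_defs)
  next
    case False
    then obtain a b c d where "x = Pair a b" "y = Pair c d" by (metis data.exhaust)
    then show thesis
      by (intro that[of "(a, c) # (b, d) # qs" r]) (auto simp: ps eq_defs)
  qed
qed

lemma loop_run_eq_step:
  assumes "size (eq_state ps r) \<le> M"
  shows "\<exists>n \<le> eq_cost ps.
    loop_run eq_step {s. size s \<le> M} n (eq_state ps r) (Pair Atom (eq_result ps r))"
  using assms
proof (induction ps arbitrary: r rule: measure_induct_rule[of eq_cost])
  case (less ps)
  show ?case
  proof (cases "ps = []")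
    case True
    with less.prems show ?thesis
      by (auto simp: eq_state_def eq_result_def eq_cost_def intro: loop_stop)
  next
    case False
    then obtain ps' r' where step: "eq_step (eq_state ps r) = eq_state ps' r'"
      "size (eq_state ps' r') \<le> size (eq_state ps r)" "eq_cost ps' < eq_cost ps"
      "eq_result ps' r' = eq_result ps r"
      by (rule eq_step_eq_state)
    then obtain n where n: "n \<le> eq_cost ps'" "loop_run eq_step {s. size s \<le> M} n
        (eq_step (eq_state ps r)) (Pair Atom (eq_result ps r))"
      using less.IH[of ps' r'] less.prems by auto
    have "left (eq_state ps r) \<noteq> Atom" using False by (cases ps) (auto simp: eq_state_def)
    then have "loop_run eq_step {s. size s \<le> M} (Suc n) (eq_state ps r)
        (Pair Atom (eq_result ps r))"
      using less.prems n(2) by (intro loop_step) auto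
    then show ?thesis using n(1) step(3) by (intro exI[of _ "Suc n"]) simp
  qed
qed

lemma ptime_pred_eq:
  assumes "ptime D f" "ptime D g"
  shows "ptime_pred D (\<lambda>d. f d = g d)"
proof -
  have "ptime UNIV (\<lambda>p. Pair Atom (dbool (left p = right p)))"
  proof (rule ptime_loop[OF ptime_eq_step, where D' = UNIV])
    show "ptime UNIV (\<lambda>p. Pair (Pair (Pair (left p) (right p)) Atom) (Pair Atom Atom))"
      by (intro ptime_Pair ptime_left ptime_right ptime_Atom ptime_id)
    show "poly_bounded UNIV (\<lambda>p. 2 * size (left p) + 1)"
      "poly_bounded UNIV (\<lambda>p. size (left p) + size (right p) + 4)"
      by (intro poly_bounded_intros poly_bounded_ptime ptime_left ptime_right ptime_id)+
    show "\<exists>n \<le> 2 * size (left p) + 1.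
      loop_run eq_step {s \<in> UNIV. size s \<le> size (left p) + size (right p) + 4} n
        (Pair (Pair (Pair (left p) (right p)) Atom) (Pair Atom Atom))
        (Pair Atom (dbool (left p = right p)))" for p
      using loop_run_eq_step[of "[(left p, right p)]" "Pair Atom Atom"]
      by (simp add: dbool_def eq_state_def eq_cost_def eq_result_def)
  qed
  from ptime_right[OF ptime_compose[OF ptime_Pair[OF assms] this subset_UNIV]]
  show ?thesis by simp
qed


subsection \<open>Folds\<close>

text \<open>
  A higher-order argument sees the input \<open>d\<close> as a context: it is a function of pairs \<open>p\<close> with
  \<open>right p = d\<close>.
\<close>

lemma ptime_context: "ptime D f \<Longrightarrow> ptime (right -` D) (\<lambda>p. f (right p))"
  by (rule ptime_compose[OF ptime_right[OF ptime_id]]) auto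

lemma loop_run_fold:
  assumes step: "\<And>x l a. step (Pair (Pair x l) (Pair a c)) = Pair l (Pair (b x a) c)"
    and Q: "\<And>i. Pair (dlist (drop i xs)) (Pair (fold b (take i xs) a) c) \<in> Q"
  shows "loop_run step Q (length xs)
    (Pair (dlist xs) (Pair a c)) (Pair Atom (Pair (fold b xs a) c))"
  using Q
proof (induction xs arbitrary: a)
  case Nil
  then show ?case by (auto intro: loop_stop)
next
  case (Cons x xs)
  have "loop_run step Q (length xs) (Pair (dlist xs) (Pair (b x a) c))
      (Pair Atom (Pair (fold b xs (b x a)) c))"
    using Cons.prems[of "Suc _"] by (intro Cons.IH) simp
  then show ?case
    using Cons.prems[of 0] by (auto simp: step intro: loop_step)
qed

lemma size_dlist_rev [simp]: "size (dlist (rev xs)) = size (dlist xs)"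
  by (simp add: size_dlist flip: rev_map)

lemma size_dlist_drop_le: "size (dlist (drop i xs)) \<le> size (dlist xs)"
  and size_dlist_take_le: "size (dlist (take i xs)) \<le> size (dlist xs)"
  using size_dlist_append[of "take i xs" "drop i xs"] by simp_all

lemma ptime_fold:
  assumes b: "ptime (right -` right -` D) (\<lambda>p. b (left p) (left (right p)) (right (right p)))"
    and l: "ptime_list D l" and a: "ptime D a" and M: "poly_bounded D M"
    and bound: "\<And>d i. d \<in> D \<Longrightarrow> size (fold (\<lambda>x y. b x y d) (take i (l d)) (a d)) \<le> M d"
  shows "ptime D (\<lambda>d. fold (\<lambda>x y. b x y d) (l d) (a d))"
proof -
  define step where "step s = Pair (right (left s))
    (Pair (b (left (left s)) (left (right s)) (right (right s))) (right (right s)))" for s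
  let ?D = "right -` right -` D"
  have "(\<lambda>s. Pair (left (left s)) (right s)) ` ?D \<subseteq> ?D" by auto
  from ptime_compose[OF ptime_Pair[OF ptime_left[OF ptime_left[OF ptime_id]]
        ptime_right[OF ptime_id]] b this]
  have "ptime ?D (\<lambda>s. b (left (left s)) (left (right s)) (right (right s)))" by simp
  then have "ptime ?D step"
    unfolding step_def by (intro ptime_Pair ptime_left ptime_right ptime_id)
  then have "ptime D (\<lambda>d. Pair Atom (Pair (fold (\<lambda>x y. b x y d) (l d) (a d)) d))"
  proof (rule ptime_loop)
    show "ptime D (\<lambda>d. Pair (dlist (l d)) (Pair (a d) d))"
      by (intro ptime_Pair l a ptime_id)
    show "poly_bounded D (\<lambda>d. size (dlist (l d)))"
      "poly_bounded D (\<lambda>d. size (dlist (l d)) + M d + size d + 2)"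
      by (intro poly_bounded_intros poly_bounded_ptime l M)+
    fix d assume d: "d \<in> D"
    have "size (Pair (dlist (drop i (l d))) (Pair (fold (\<lambda>x y. b x y d) (take i (l d)) (a d)) d))
        \<le> size (dlist (l d)) + M d + size d + 2" for i
      using bound[OF d, of i] size_dlist_drop_le[of i "l d"] by simp
    then show "\<exists>n \<le> size (dlist (l d)).
        loop_run step {s \<in> ?D. size s \<le> size (dlist (l d)) + M d + size d + 2} n
          (Pair (dlist (l d)) (Pair (a d) d))
          (Pair Atom (Pair (fold (\<lambda>x y. b x y d) (l d) (a d)) d))"
      using d length_le_size_dlist
      by (intro exI[of _ "length (l d)"] conjI loop_run_fold) (auto simp: step_def)
  qed
  from ptime_left[OF ptime_right[OF this]] show ?thesis by simp
qed

lemma fold_Pair_Atom: "fold Pair xs Atom = dlist (rev xs)"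
  by (induction xs rule: rev_induct) auto

lemma ptime_list_rev:
  assumes "ptime_list D f"
  shows "ptime_list D (\<lambda>d. rev (f d))"
proof -
  have "ptime D (\<lambda>d. fold (\<lambda>x y. Pair x y) (f d) Atom)"
  proof (rule ptime_fold[OF _ assms ptime_Atom poly_bounded_ptime[OF assms]])
    show "size (fold Pair (take i (f d)) Atom) \<le> size (dlist (f d))" for i d
      using size_dlist_take_le[of i "f d"] by (simp add: fold_Pair_Atom)
  qed (intro ptime_Pair ptime_left ptime_right ptime_id)
  then show ?thesis by (simp add: fold_Pair_Atom)
qed

text \<open>The accumulator is represented by \<open>r\<close>, which will be \<open>dlist\<close> or \<open>unary\<close>.\<close>

lemma ptime_foldr:
  fixes r :: "'b \<Rightarrow> data" and r' :: "data \<Rightarrow> 'b"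
  assumes inverse: "\<And>y. r' (r y) = y"
    and b: "ptime (right -` right -` D)
      (\<lambda>p. r (b (left p) (r' (left (right p))) (right (right p))))"
    and l: "ptime_list D l" and a: "ptime D (\<lambda>d. r (a d))" and M: "poly_bounded D M"
    and bound: "\<And>d i. d \<in> D \<Longrightarrow> size (r (foldr (\<lambda>x y. b x y d) (drop i (l d)) (a d))) \<le> M d"
  shows "ptime D (\<lambda>d. r (foldr (\<lambda>x y. b x y d) (l d) (a d)))"
proof -
  have fold: "fold (\<lambda>x y. r (b x (r' y) d)) (rev xs) (r y) = r (foldr (\<lambda>x y. b x y d) xs y)"
    for xs y d
    by (induction xs) (auto simp: inverse)
  have "ptime D (\<lambda>d. fold (\<lambda>x y. r (b x (r' y) d)) (rev (l d)) (r (a d)))"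
  proof (rule ptime_fold[OF b ptime_list_rev[OF l] a M])
    show "size (fold (\<lambda>x y. r (b x (r' y) d)) (take i (rev (l d))) (r (a d))) \<le> M d"
      if "d \<in> D" for d i
      unfolding take_rev fold by (rule bound[OF that])
  qed
  then show ?thesis unfolding fold .
qed

lemma ptime_funpow:
  fixes r :: "'b \<Rightarrow> data" and r' :: "data \<Rightarrow> 'b"
  assumes inverse: "\<And>y. r' (r y) = y"
    and f: "ptime (right -` D) (\<lambda>p. r (f (right p) (r' (left p))))"
    and n: "ptime_nat D n" and a: "ptime D (\<lambda>d. r (a d))" and M: "poly_bounded D M"
    and bound: "\<And>d i. d \<in> D \<Longrightarrow> size (r ((f d ^^ i) (a d))) \<le> M d"
  shows "ptime D (\<lambda>d. r ((f d ^^ n d) (a d)))"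
proof -
  have "ptime D (\<lambda>d. r (foldr (\<lambda>_ y. f d y) (replicate (n d) Atom) (a d)))"
  proof (rule ptime_foldr[OF inverse _ _ a M])
    show "ptime (right -` right -` D) (\<lambda>p. r (f (right (right p)) (r' (left (right p)))))"
      by (rule ptime_context[OF f])
    show "ptime_list D (\<lambda>d. replicate (n d) Atom)" using n by (simp add: unary_def)
    show "size (r (foldr (\<lambda>_ y. f d y) (drop i (replicate (n d) Atom)) (a d))) \<le> M d"
      if "d \<in> D" for d i
      using bound[OF that] by simp
  qed
  then show ?thesis by simp
qed

lemmas ptime_list_foldr = ptime_foldr[of elems dlist, OF elems_dlist]
  and ptime_list_funpow = ptime_funpow[of elems dlist, OF elems_dlist]
  and ptime_nat_foldr = ptime_foldr[of "\<lambda>d. length (elems d)" unary, OF length_elems_unary]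
  and ptime_nat_funpow = ptime_funpow[of "\<lambda>d. length (elems d)" unary, OF length_elems_unary]


subsection \<open>List comprehension and bounded quantifiers\<close>

lemma ptime_list_elems: "ptime D f \<Longrightarrow> ptime_list D (\<lambda>d. elems (f d))"
  by simp

lemma ptime_list_Nil: "ptime_list D (\<lambda>_. [])"
  by (simp add: ptime_Atom)

lemma ptime_list_Cons: "ptime D f \<Longrightarrow> ptime_list D g \<Longrightarrow> ptime_list D (\<lambda>d. f d # g d)"
  by (simp add: ptime_Pair)

lemmas ptime_basic_intros =
  ptime_id ptime_Atom ptime_Pair ptime_left ptime_right ptime_If ptime_list_If ptime_nat_If
  ptime_pred_True ptime_pred_False ptime_pred_not ptime_pred_conj ptime_pred_disj ptime_pred_eq
  ptime_list_elems ptime_list_Nil ptime_list_Cons ptime_context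

lemma ptime_list_append:
  assumes f: "ptime_list D f" and g: "ptime_list D g"
  shows "ptime_list D (\<lambda>d. f d @ g d)"
proof -
  have foldr: "foldr (\<lambda>x ys. x # ys) xs ys = xs @ ys" for xs ys :: "data list"
    by (induction xs) auto
  have "ptime_list D (\<lambda>d. foldr (\<lambda>x ys. x # ys) (f d) (g d))"
  proof (rule ptime_list_foldr[OF _ f g])
    show "poly_bounded D (\<lambda>d. size (dlist (f d)) + size (dlist (g d)))"
      by (intro poly_bounded_intros poly_bounded_ptime f g)
    show "size (dlist (foldr (\<lambda>x ys. x # ys) (drop i (f d)) (g d)))
        \<le> size (dlist (f d)) + size (dlist (g d))" for d i
      using size_dlist_drop_le[of i "f d"] by (simp add: foldr)
  qed (intro ptime_basic_intros)
  then show ?thesis by (simp add: foldr)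
qed

lemma size_dlist_concat_map_le:
  assumes "\<And>x. x \<in> set xs \<Longrightarrow> size (dlist (h x)) \<le> m"
  shows "size (dlist (concat (map h xs))) \<le> length xs * m"
  using assms by (induction xs) (auto simp: add_mono)

lemma poly_bounded_context:
  assumes "poly_bounded (right -` D) (\<lambda>p. g (left p) (right p))" and l: "ptime_list D l"
  obtains m where "poly_bounded D m" "\<And>d x. d \<in> D \<Longrightarrow> x \<in> set (l d) \<Longrightarrow> g x d \<le> m d"
proof -
  obtain q where q: "\<And>p. right p \<in> D \<Longrightarrow> g (left p) (right p) \<le> poly q (size p)"
    using assms(1) unfolding poly_bounded_def by auto
  show thesis
  proof (rule that)
    show "poly_bounded D (\<lambda>d. poly q (size (dlist (l d)) + size d + 1))"
      by (intro poly_bounded_intros poly_bounded_poly poly_bounded_ptime l)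
    fix d x assume "d \<in> D" and x: "x \<in> set (l d)"
    then have "g x d \<le> poly q (size (Pair x d))" using q[of "Pair x d"] by simp
    also have "\<dots> \<le> poly q (size (dlist (l d)) + size d + 1)"
      using size_le_size_dlist[OF x] by (intro poly_nat_mono) simp
    finally show "g x d \<le> poly q (size (dlist (l d)) + size d + 1)" .
  qed
qed

lemma ptime_list_concat_map:
  assumes h: "ptime_list (right -` D) (\<lambda>p. h (left p) (right p))" and l: "ptime_list D l"
  shows "ptime_list D (\<lambda>d. concat (map (\<lambda>x. h x d) (l d)))"
proof -
  obtain m where m: "poly_bounded D m"
    "\<And>d x. d \<in> D \<Longrightarrow> x \<in> set (l d) \<Longrightarrow> size (dlist (h x d)) \<le> m d"
    using poly_bounded_context[OF poly_bounded_ptime[OF h] l] by blast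
  have foldr: "foldr (\<lambda>x ys. h x d @ ys) xs [] = concat (map (\<lambda>x. h x d) xs)" for d xs
    by (induction xs) auto
  have "ptime_list D (\<lambda>d. foldr (\<lambda>x ys. h x d @ ys) (l d) [])"
  proof (rule ptime_list_foldr[OF _ l ptime_list_Nil])
    have "(\<lambda>p. Pair (left p) (right (right p))) ` (right -` right -` D) \<subseteq> right -` D" by auto
    from ptime_compose[OF ptime_Pair[OF ptime_left[OF ptime_id]
          ptime_right[OF ptime_right[OF ptime_id]]] h this]
    have "ptime_list (right -` right -` D) (\<lambda>p. h (left p) (right (right p)))" by simp
    then show "ptime_list (right -` right -` D)
        (\<lambda>p. h (left p) (right (right p)) @ elems (left (right p)))"
      by (rule ptime_list_append) (intro ptime_basic_intros)
    show "poly_bounded D (\<lambda>d. size (dlist (l d)) * m d)"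
      by (intro poly_bounded_intros m(1) poly_bounded_ptime l)
    fix d i assume d: "d \<in> D"
    have "size (dlist (concat (map (\<lambda>x. h x d) (drop i (l d))))) \<le> length (drop i (l d)) * m d"
      by (intro size_dlist_concat_map_le m(2)[OF d]) (rule in_set_dropD)
    also have "\<dots> \<le> size (dlist (l d)) * m d"
      using length_le_size_dlist[of "l d"] by (intro mult_le_mono1) simp
    finally show "size (dlist (foldr (\<lambda>x ys. h x d @ ys) (drop i (l d)) []))
        \<le> size (dlist (l d)) * m d"
      by (simp add: foldr)
  qed
  then show ?thesis by (simp add: foldr)
qed

lemma ptime_list_filter:
  assumes "ptime_pred (right -` D) (\<lambda>p. P (left p) (right p))" and "ptime_list D l"
  shows "ptime_list D (\<lambda>d. filter (\<lambda>x. P x d) (l d))"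
proof -
  have "concat (map (\<lambda>x. if P x d then [x] else []) xs) = filter (\<lambda>x. P x d) xs" for xs d
    by (induction xs) auto
  moreover have "ptime_list D (\<lambda>d. concat (map (\<lambda>x. if P x d then [x] else []) (l d)))"
    by (intro ptime_list_concat_map ptime_basic_intros assms)
  ultimately show ?thesis by simp
qed

lemma ptime_list_map:
  assumes "ptime (right -` D) (\<lambda>p. f (left p) (right p))" and "ptime_list D l"
  shows "ptime_list D (\<lambda>d. map (\<lambda>x. f x d) (l d))"
proof -
  have "ptime_list D (\<lambda>d. concat (map (\<lambda>x. [f x d]) (l d)))"
    by (intro ptime_list_concat_map ptime_basic_intros assms)
  then show ?thesis by simp
qed

lemma ptime_pred_Bex:
  assumes "ptime_pred (right -` D) (\<lambda>p. P (left p) (right p))" and "ptime_list D l"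
  shows "ptime_pred D (\<lambda>d. \<exists>x \<in> set (l d). P x d)"
proof -
  have "ptime_pred D (\<lambda>d. \<not> dlist (filter (\<lambda>x. P x d) (l d)) = Atom)"
    by (intro ptime_pred_not ptime_pred_eq_Atom ptime_list_filter assms)
  moreover have "dlist xs = Atom \<longleftrightarrow> xs = []" for xs by (cases xs) auto
  ultimately show ?thesis by (simp add: filter_empty_conv)
qed

lemma ptime_pred_mem:
  assumes "ptime D f" and "ptime_list D l"
  shows "ptime_pred D (\<lambda>d. f d \<in> set (l d))"
proof -
  have "ptime_pred D (\<lambda>d. \<exists>x \<in> set (l d). x = f d)"
    by (intro ptime_pred_Bex ptime_basic_intros assms)
  then show ?thesis by simp
qed

lemma ptime_list_remdups:
  assumes "ptime_list D l"
  shows "ptime_list D (\<lambda>d. remdups (l d))"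
proof -
  let ?ins = "\<lambda>x xs. if x \<in> set xs then xs else x # xs"
  have foldr: "foldr ?ins xs [] = remdups xs" for xs :: "data list"
    by (induction xs) auto
  have size: "size (dlist (remdups xs)) \<le> size (dlist xs)" for xs
    by (induction xs) auto
  have "ptime_list D (\<lambda>d. foldr ?ins (l d) [])"
  proof (rule ptime_list_foldr[OF _ assms ptime_list_Nil poly_bounded_ptime[OF assms]])
    show "size (dlist (foldr ?ins (drop i (l d)) [])) \<le> size (dlist (l d))" for i d
      unfolding foldr using size size_dlist_drop_le order_trans by blast
  qed (intro ptime_pred_mem ptime_basic_intros)
  then show ?thesis by (simp add: foldr)
qed


subsection \<open>Unary arithmetic\<close>

lemma ptime_nat_Suc: "ptime_nat D f \<Longrightarrow> ptime_nat D (\<lambda>d. Suc (f d))"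
  by (simp add: ptime_Pair ptime_Atom)

lemma ptime_nat_add:
  assumes "ptime_nat D f" "ptime_nat D g"
  shows "ptime_nat D (\<lambda>d. f d + g d)"
  using ptime_list_append[of D "\<lambda>d. replicate (f d) Atom" "\<lambda>d. replicate (g d) Atom"] assms
  by (simp add: unary_def replicate_add)

lemma ptime_nat_of_bool: "ptime_pred D P \<Longrightarrow> ptime_nat D (\<lambda>d. of_bool (P d))"
  by (erule ptime_cong) (simp add: dbool_def)

lemma ptime_nat_length:
  assumes "ptime_list D l"
  shows "ptime_nat D (\<lambda>d. length (l d))"
  using ptime_list_map[OF ptime_Atom assms] by (simp add: unary_def map_replicate_const)

lemma ptime_nat_diff:
  assumes f: "ptime_nat D f" and g: "ptime_nat D g"
  shows "ptime_nat D (\<lambda>d. f d - g d)"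
proof -
  have funpow: "((\<lambda>m. m - 1) ^^ n) m = m - n" for m n :: nat
    by (induction n) auto
  have "ptime_nat D (\<lambda>d. ((\<lambda>m. m - 1) ^^ g d) (f d))"
  proof (rule ptime_nat_funpow[OF _ g f poly_bounded_ptime[OF f]])
    have length: "length (elems x) - 1 = length (elems (right x))" for x by (cases x) auto
    show "ptime_nat (right -` D) (\<lambda>p. length (elems (left p)) - 1)"
      unfolding length by (intro ptime_nat_length ptime_basic_intros)
    show "size (unary (((\<lambda>m. m - 1) ^^ i) (f d))) \<le> size (unary (f d))" for d i
      unfolding funpow by simp
  qed
  then show ?thesis unfolding funpow .
qed

lemma ptime_pred_le:
  assumes "ptime_nat D f" "ptime_nat D g"
  shows "ptime_pred D (\<lambda>d. f d \<le> g d)"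
proof -
  have "unary n = Atom \<longleftrightarrow> n = 0" for n by (cases n) auto
  then show ?thesis
    using ptime_pred_eq_Atom[OF ptime_nat_diff[OF assms]] by simp
qed

lemma ptime_nat_min:
  assumes "ptime_nat D f" "ptime_nat D g"
  shows "ptime_nat D (\<lambda>d. min (f d) (g d))"
  unfolding min_def by (intro ptime_nat_If ptime_pred_le assms)

definition nat_of_bits :: "data list \<Rightarrow> nat" where
  "nat_of_bits bs = horner_sum (\<lambda>b. of_bool (b \<noteq> Atom)) 2 bs"

text \<open>
  The truncation at \<open>n\<close> keeps the unary representation of a number given in binary short.
\<close>

lemma ptime_nat_min_nat_of_bits:
  assumes l: "ptime_list D l" and n: "ptime_nat D n"
  shows "ptime_nat D (\<lambda>d. min (nat_of_bits (l d)) (n d))"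
proof -
  have foldr: "foldr (\<lambda>b m. min (of_bool (b \<noteq> Atom) + (m + m)) k) bs 0 = min (nat_of_bits bs) k"
    for bs and k :: nat
    by (induction bs) (auto simp: nat_of_bits_def)
  have "ptime_nat D (\<lambda>d. foldr (\<lambda>b m. min (of_bool (b \<noteq> Atom) + (m + m)) (n d)) (l d) 0)"
  proof (rule ptime_nat_foldr[OF _ l])
    show "ptime_nat (right -` right -` D) (\<lambda>p. min (of_bool (left p \<noteq> Atom) +
        (length (elems (left (right p))) + length (elems (left (right p))))) (n (right (right p))))"
      by (intro ptime_nat_min ptime_nat_add ptime_nat_of_bool ptime_nat_length ptime_basic_intros n)
    show "ptime_nat D (\<lambda>_. 0)" by (simp add: ptime_Atom)
    show "poly_bounded D n" using poly_bounded_ptime[OF n] by simp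
  qed (simp add: foldr)
  then show ?thesis by (simp add: foldr)
qed

lemmas ptime_intros = ptime_basic_intros ptime_list_append ptime_list_concat_map ptime_list_filter
  ptime_list_map ptime_list_remdups ptime_pred_Bex ptime_pred_mem ptime_pred_le ptime_nat_length
  ptime_nat_Suc


section \<open>Iterating and transporting relations\<close>

lemma funpow_Un_Image: "((\<lambda>X. X \<union> r `` X) ^^ n) A = (\<Union>i \<le> n. (r ^^ i) `` A)"
proof (induction n)
  case (Suc n)
  have "((\<lambda>X. X \<union> r `` X) ^^ Suc n) A = (\<Union>i \<in> {..n} \<union> Suc ` {..n}. (r ^^ i) `` A)"
    unfolding UN_Un by (auto simp: Suc Image_UN relcomp_Image)
  also have "{..n} \<union> Suc ` {..n} = {..Suc n}"
    using atMost_Suc_eq_insert_0[of n] by auto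
  finally show ?case .
qed simp

lemma rtrancl_map:
  assumes "\<And>x y. (x, y) \<in> r \<Longrightarrow> (f x, f y) \<in> r'" and "(a, b) \<in> r\<^sup>*"
  shows "(f a, f b) \<in> r'\<^sup>*"
  using assms(2) by (induction rule: rtrancl_induct) (auto intro: assms(1) rtrancl_into_rtrancl)

lemma rtrancl_map_prod_iff:
  assumes inj: "inj_on h A" and r: "r \<subseteq> A \<times> A" and ab: "a \<in> A" "b \<in> A"
  shows "(h a, h b) \<in> (map_prod h h ` r)\<^sup>* \<longleftrightarrow> (a, b) \<in> r\<^sup>*"
proof
  assume path: "(h a, h b) \<in> (map_prod h h ` r)\<^sup>*"
  have "(the_inv_into A h x, the_inv_into A h y) \<in> r" if "(x, y) \<in> map_prod h h ` r" for x y
    using that r by (auto simp: the_inv_into_f_f[OF inj] subset_iff)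
  from rtrancl_map[where f = "the_inv_into A h", OF this path] show "(a, b) \<in> r\<^sup>*"
    by (simp add: the_inv_into_f_f[OF inj] ab)
next
  assume "(a, b) \<in> r\<^sup>*"
  then show "(h a, h b) \<in> (map_prod h h ` r)\<^sup>*"
    by (rule rtrancl_map[where f = h, rotated]) force
qed

lemma successively_iff_rtrancl:
  "(\<exists>xs. xs \<noteq> [] \<and> hd xs = a \<and> last xs = b \<and> (\<forall>x \<in> set xs. P x) \<and> successively r xs) \<longleftrightarrow>
   P a \<and> (a, b) \<in> {(x, y). P x \<and> P y \<and> r x y}\<^sup>*"
proof
  have "P (hd xs) \<and> (hd xs, last xs) \<in> {(x, y). P x \<and> P y \<and> r x y}\<^sup>*"
    if "xs \<noteq> []" "\<forall>x \<in> set xs. P x" "successively r xs" for xs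
    using that
  proof (induction xs rule: list_nonempty_induct)
    case (cons x xs)
    then show ?case
      by (auto simp: successively_Cons intro!: converse_rtrancl_into_rtrancl[of x "hd xs"])
  qed simp
  then show "\<exists>xs. xs \<noteq> [] \<and> hd xs = a \<and> last xs = b \<and> (\<forall>x \<in> set xs. P x) \<and> successively r xs \<Longrightarrow>
    P a \<and> (a, b) \<in> {(x, y). P x \<and> P y \<and> r x y}\<^sup>*" by blast
next
  assume path: "P a \<and> (a, b) \<in> {(x, y). P x \<and> P y \<and> r x y}\<^sup>*"
  then have "(a, b) \<in> {(x, y). P x \<and> P y \<and> r x y}\<^sup>*" by blast
  then show "\<exists>xs. xs \<noteq> [] \<and> hd xs = a \<and> last xs = b \<and> (\<forall>x \<in> set xs. P x) \<and> successively r xs"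
  proof (induction rule: rtrancl_induct)
    case base
    then show ?case using path by (intro exI[of _ "[a]"]) auto
  next
    case (step y z)
    then obtain xs where
      "xs \<noteq> []" "hd xs = a" "last xs = y" "\<forall>x \<in> set xs. P x" "successively r xs" by blast
    then show ?case using step(2)
      by (intro exI[of _ "xs @ [z]"]) (auto simp: successively_append_iff)
  qed
qed


section \<open>Enumerating minimal separators\<close>

subsection \<open>Components and their neighbourhoods\<close>

definition avoiding :: "('a \<times> 'a) set \<Rightarrow> 'a set \<Rightarrow> ('a \<times> 'a) set" where
  "avoiding E X = {(u, v) \<in> E. u \<notin> X \<and> v \<notin> X}"

definition comp_of :: "('a \<times> 'a) set \<Rightarrow> 'a set \<Rightarrow> 'a \<Rightarrow> 'a set" where
  "comp_of E X t = (avoiding E X)\<^sup>* `` {t}"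

definition nbrs :: "('a \<times> 'a) set \<Rightarrow> 'a set \<Rightarrow> 'a set" where
  "nbrs E C = E `` C - C"

definition core :: "('a \<times> 'a) set \<Rightarrow> 'a \<Rightarrow> 'a set \<Rightarrow> 'a set" where
  "core E t X = nbrs E (comp_of E X t)"

lemma comp_of_self [simp]: "v \<in> comp_of E X v"
  by (simp add: comp_of_def)

lemma comp_of_sym: "sym E \<Longrightarrow> u \<in> comp_of E X v \<longleftrightarrow> v \<in> comp_of E X u"
  using sym_rtrancl[of "avoiding E X"] by (auto simp: comp_of_def avoiding_def sym_def)

lemma comp_of_step:
  "u \<in> comp_of E X v \<Longrightarrow> (u, w) \<in> E \<Longrightarrow> u \<notin> X \<Longrightarrow> w \<notin> X \<Longrightarrow> w \<in> comp_of E X v"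
  unfolding comp_of_def by (auto simp: avoiding_def intro: rtrancl_into_rtrancl)

lemma comp_of_trans: "u \<in> comp_of E X v \<Longrightarrow> w \<in> comp_of E X u \<Longrightarrow> w \<in> comp_of E X v"
  unfolding comp_of_def by auto

lemma comp_of_least:
  assumes "v \<in> C" and "\<And>u w. u \<in> C \<Longrightarrow> (u, w) \<in> E \<Longrightarrow> u \<notin> X \<Longrightarrow> w \<notin> X \<Longrightarrow> w \<in> C"
  shows "comp_of E X v \<subseteq> C"
proof -
  have "u \<in> C" if "(v, u) \<in> (avoiding E X)\<^sup>*" for u
    using that by (induction rule: rtrancl_induct) (use assms in \<open>auto simp: avoiding_def\<close>)
  then show ?thesis by (auto simp: comp_of_def)
qed

lemma comp_of_disjoint: "v \<notin> X \<Longrightarrow> comp_of E X v \<inter> X = {}"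
  using comp_of_least[of v "- X" E X] by blast

lemma comp_of_subset: "v \<in> V \<Longrightarrow> E \<subseteq> V \<times> V \<Longrightarrow> comp_of E X v \<subseteq> V"
  by (rule comp_of_least) auto

lemma comp_of_mono:
  assumes "comp_of E X v \<inter> Y = {}" shows "comp_of E X v \<subseteq> comp_of E Y v"
proof -
  have "comp_of E X v \<subseteq> comp_of E X v \<inter> comp_of E Y v"
    by (rule comp_of_least) (use assms in \<open>auto intro: comp_of_step\<close>)
  then show ?thesis by blast
qed

lemma comp_of_antimono: "Y \<subseteq> X \<Longrightarrow> v \<notin> X \<Longrightarrow> comp_of E X v \<subseteq> comp_of E Y v"
  using comp_of_disjoint[of v X] by (intro comp_of_mono) auto

lemma core_subset: "t \<notin> X \<Longrightarrow> core E t X \<subseteq> X"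
  using comp_of_disjoint[of t X] unfolding core_def nbrs_def by (blast intro: comp_of_step)

lemma comp_of_core:
  assumes "t \<notin> X" shows "comp_of E (core E t X) t = comp_of E X t"
proof
  show "comp_of E (core E t X) t \<subseteq> comp_of E X t"
    by (rule comp_of_least) (auto simp: core_def nbrs_def)
  show "comp_of E X t \<subseteq> comp_of E (core E t X) t"
    by (rule comp_of_antimono[OF core_subset]) (use assms in auto)
qed

lemma coreE:
  assumes "x \<in> core E t X"
  obtains y where "y \<in> comp_of E X t" "(y, x) \<in> E" "x \<notin> comp_of E X t"
  using assms by (auto simp: core_def nbrs_def)


subsection \<open>Minimal separators\<close>

locale st_graph =
  fixes V :: "'a set" and E :: "('a \<times> 'a) set" and s t :: 'a
  assumes finite_V: "finite V" and E_subset: "E \<subseteq> V \<times> V" and sym_E: "sym E"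
    and s_V: "s \<in> V" and t_V: "t \<in> V" and s_neq_t: "s \<noteq> t" and not_adj: "(s, t) \<notin> E"
begin

definition is_sep :: "'a set \<Rightarrow> bool" where
  "is_sep S \<longleftrightarrow> S \<subseteq> V - {s, t} \<and> s \<notin> comp_of E S t"

definition is_minsep :: "'a set \<Rightarrow> bool" where
  "is_minsep S \<longleftrightarrow> is_sep S \<and> (\<forall>S'. S' \<subset> S \<longrightarrow> \<not> is_sep S')"

lemma E_sym: "(u, v) \<in> E \<Longrightarrow> (v, u) \<in> E"
  using sym_E by (rule symD)

lemma finite_comp_of_t: "finite (comp_of E X t)"
  using finite_subset[OF comp_of_subset[OF t_V E_subset] finite_V] .

lemma is_sep_subset: "is_sep S \<Longrightarrow> S \<subseteq> V - {s, t}"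
  by (simp add: is_sep_def)

lemma is_sep_finite: "is_sep S \<Longrightarrow> finite S"
  using is_sep_subset finite_subset[OF _ finite_V] by blast

lemma is_sep_superset: "is_sep S \<Longrightarrow> S \<subseteq> S' \<Longrightarrow> S' \<subseteq> V - {s, t} \<Longrightarrow> is_sep S'"
  unfolding is_sep_def using comp_of_antimono[of S S' t E] by blast

lemma is_sep_Un: "is_sep X \<Longrightarrow> is_sep Y \<Longrightarrow> is_sep (X \<union> Y)"
  by (rule is_sep_superset[of X]) (auto dest: is_sep_subset)

lemma is_minsepD:
  assumes "is_minsep S"
  shows "is_sep S" "S \<subseteq> V" "s \<notin> S" "t \<notin> S" "s \<notin> comp_of E S t"
  using assms by (auto simp: is_minsep_def is_sep_def)

lemma minsep_comp_of_disjoint: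
  assumes "is_minsep S"
  shows "comp_of E S s \<inter> S = {}" "comp_of E S t \<inter> S = {}" "comp_of E S s \<inter> comp_of E S t = {}"
proof -
  show "comp_of E S s \<inter> S = {}" "comp_of E S t \<inter> S = {}"
    using is_minsepD[OF assms] by (simp_all add: comp_of_disjoint)
  show "comp_of E S s \<inter> comp_of E S t = {}"
    using is_minsepD(5)[OF assms] comp_of_sym[OF sym_E, of s S] comp_of_trans[of _ E S t s] by blast
qed

lemma finite_minseps: "finite {S. is_minsep S}"
  by (rule finite_subset[of _ "Pow V"]) (use is_minsepD(2) finite_V in auto)

lemma minsep_eq: "is_minsep S \<Longrightarrow> is_minsep T \<Longrightarrow> S \<subseteq> T \<Longrightarrow> S = T"
  unfolding is_minsep_def by blast

lemma ex_minsep_subset: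
  assumes "is_sep S" obtains M where "is_minsep M" "M \<subseteq> S"
proof -
  have "finite {M. M \<subseteq> S \<and> is_sep M}" using is_sep_finite[OF assms] by simp
  then obtain M where "M \<in> {M. M \<subseteq> S \<and> is_sep M}"
    "\<forall>M' \<in> {M. M \<subseteq> S \<and> is_sep M}. M' \<subseteq> M \<longrightarrow> M = M'"
    using finite_has_minimal[of "{M. M \<subseteq> S \<and> is_sep M}"] assms by blast
  then show thesis using that[of M] unfolding is_minsep_def by blast
qed

lemma minsep_nbr_t:
  assumes S: "is_minsep S" and x: "x \<in> S"
  shows "\<exists>y \<in> comp_of E S t. (y, x) \<in> E"
proof (rule ccontr)
  assume no: "\<not> ?thesis"
  have "comp_of E (S - {x}) t \<subseteq> comp_of E S t"
  proof (rule comp_of_least)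
    fix u w assume u: "u \<in> comp_of E S t" and uw: "(u, w) \<in> E" "w \<notin> S - {x}"
    have "u \<notin> S" using u minsep_comp_of_disjoint(2)[OF S] by blast
    moreover have "w \<noteq> x" using no u uw by blast
    ultimately show "w \<in> comp_of E S t" using u uw by (auto intro: comp_of_step)
  qed simp
  with is_minsepD[OF S] have "is_sep (S - {x})" by (auto simp: is_sep_def)
  moreover have "S - {x} \<subset> S" using x by auto
  ultimately show False using S by (auto simp: is_minsep_def)
qed

lemma st_graph_swap: "st_graph V E t s"
  by unfold_locales (use finite_V E_subset sym_E s_V t_V s_neq_t not_adj E_sym in auto)

lemma is_sep_swap: "st_graph.is_sep V E t s S \<longleftrightarrow> is_sep S"
  unfolding st_graph.is_sep_def[OF st_graph_swap] is_sep_def using comp_of_sym[OF sym_E] by auto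

lemma minsep_nbr_s:
  assumes "is_minsep S" and "x \<in> S"
  shows "\<exists>y \<in> comp_of E S s. (y, x) \<in> E"
  using assms st_graph.minsep_nbr_t[OF st_graph_swap, of S x]
  unfolding st_graph.is_minsep_def[OF st_graph_swap] is_minsep_def is_sep_swap by blast

lemma is_minsepI:
  assumes S: "is_sep S"
    and nbr_t: "\<And>x. x \<in> S \<Longrightarrow> \<exists>y \<in> comp_of E S t. (y, x) \<in> E"
    and nbr_s: "\<And>x. x \<in> S \<Longrightarrow> \<exists>y \<in> comp_of E S s. (y, x) \<in> E"
  shows "is_minsep S"
  unfolding is_minsep_def
proof (intro conjI allI impI notI S)
  fix S' assume S': "S' \<subset> S" "is_sep S'"
  then obtain x where x: "x \<in> S" "x \<notin> S'" by blast
  have st: "s \<notin> S" "t \<notin> S" using S by (auto simp: is_sep_def)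
  obtain y z where y: "y \<in> comp_of E S t" "(y, x) \<in> E" and z: "z \<in> comp_of E S s" "(z, x) \<in> E"
    using nbr_t nbr_s x by blast
  have "y \<notin> S" "z \<notin> S"
    using comp_of_disjoint[OF st(1), of E] comp_of_disjoint[OF st(2), of E] y z by blast+
  have y': "y \<in> comp_of E S' t" using comp_of_antimono[of S' S t E] S' st y by blast
  have z': "z \<in> comp_of E S' s" using comp_of_antimono[of S' S s E] S' st z by blast
  have "x \<in> comp_of E S' t" using y' y x \<open>y \<notin> S\<close> S' by (blast intro: comp_of_step)
  then have "z \<in> comp_of E S' t" using z x \<open>z \<notin> S\<close> S' E_sym by (blast intro: comp_of_step)
  then have "s \<in> comp_of E S' t"
    using z' comp_of_trans[of z E S' t s] comp_of_sym[OF sym_E, of z] by blast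
  then show False using S' by (auto simp: is_sep_def)
qed

lemma is_minsep_coreI:
  assumes t: "t \<notin> X" and s: "s \<notin> comp_of E X t" "s \<notin> core E t X"
    and nbr_s: "\<And>x. x \<in> core E t X \<Longrightarrow> \<exists>y \<in> comp_of E (core E t X) s. (y, x) \<in> E"
  shows "is_minsep (core E t X)"
proof (rule is_minsepI)
  show "is_sep (core E t X)"
    unfolding is_sep_def comp_of_core[OF t]
    using s core_subset[OF t] t E_subset by (auto simp: core_def nbrs_def)
  show "\<exists>y \<in> comp_of E (core E t X) t. (y, x) \<in> E" if "x \<in> core E t X" for x
    using that unfolding comp_of_core[OF t] by (auto elim: coreE)
qed (rule nbr_s)


subsection \<open>Stepping from one minimal separator to the next\<close>

definition first_sep :: "'a set" where
  "first_sep = core E t (nbrs E {s})"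

definition next_sep :: "'a set \<Rightarrow> 'a \<Rightarrow> 'a set" where
  "next_sep S x = core E t (nbrs E {x} \<union> S)"

definition next_rel :: "('a set \<times> 'a set) set" where
  "next_rel = {(S, next_sep S x) | S x. x \<in> S \<and> (x, t) \<notin> E}"

lemma t_notin_nbrs_s: "t \<notin> nbrs E {s}"
  using not_adj by (auto simp: nbrs_def)

lemma first_sep_minsep: "is_minsep first_sep"
  unfolding first_sep_def
proof (rule is_minsep_coreI[OF t_notin_nbrs_s])
  have "comp_of E (nbrs E {s}) t \<subseteq> - {s}"
    by (rule comp_of_least) (use s_neq_t E_sym in \<open>auto simp: nbrs_def\<close>)
  then show "s \<notin> comp_of E (nbrs E {s}) t" by blast
  have core: "core E t (nbrs E {s}) \<subseteq> nbrs E {s}" by (rule core_subset[OF t_notin_nbrs_s])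
  then show "s \<notin> core E t (nbrs E {s})" by (auto simp: nbrs_def)
  show "\<exists>y \<in> comp_of E (core E t (nbrs E {s})) s. (y, x) \<in> E" if "x \<in> core E t (nbrs E {s})" for x
    using that core by (auto simp: nbrs_def intro!: bexI[of _ s])
qed

lemma comp_of_first_sep_maximal:
  assumes "is_minsep T" shows "comp_of E T t \<subseteq> comp_of E first_sep t"
proof -
  have "(s, u) \<notin> E" if "u \<in> comp_of E T t" for u
    using that is_minsepD(3,5)[OF assms] minsep_comp_of_disjoint(2)[OF assms]
      comp_of_step[of u E T t s] E_sym by blast
  then have "comp_of E T t \<inter> nbrs E {s} = {}" by (auto simp: nbrs_def)
  then show ?thesis unfolding first_sep_def comp_of_core[OF t_notin_nbrs_s] by (rule comp_of_mono)
qed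

context
  fixes S :: "'a set" and x :: 'a
  assumes S: "is_minsep S" and x: "x \<in> S" "(x, t) \<notin> E"
begin

lemma t_notin_nbrs_Un: "t \<notin> nbrs E {x} \<union> S"
  using is_minsepD[OF S] x by (auto simp: nbrs_def)

lemma comp_of_next_sep: "comp_of E (next_sep S x) t = comp_of E (nbrs E {x} \<union> S) t"
  unfolding next_sep_def by (rule comp_of_core[OF t_notin_nbrs_Un])

lemma comp_of_next_sep_subset: "comp_of E (next_sep S x) t \<subseteq> comp_of E S t"
  unfolding comp_of_next_sep by (rule comp_of_antimono) (use t_notin_nbrs_Un in auto)

lemma comp_of_next_sep_disjoint_nbrs: "comp_of E (next_sep S x) t \<inter> nbrs E {x} = {}"
  unfolding comp_of_next_sep using comp_of_disjoint[OF t_notin_nbrs_Un, of E] by blast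

lemma comp_of_next_sep_psubset: "comp_of E (next_sep S x) t \<subset> comp_of E S t"
proof -
  obtain y where y: "y \<in> comp_of E S t" "(y, x) \<in> E" using minsep_nbr_t[OF S x(1)] by blast
  then have "y \<noteq> x" using x(1) minsep_comp_of_disjoint(2)[OF S] by blast
  then have "y \<in> nbrs E {x}" using y E_sym by (auto simp: nbrs_def)
  then show ?thesis using y comp_of_next_sep_subset comp_of_next_sep_disjoint_nbrs by blast
qed

lemma next_sep_subset: "next_sep S x \<subseteq> S \<union> comp_of E S t"
proof
  fix w assume "w \<in> next_sep S x"
  then obtain u where u: "u \<in> comp_of E (nbrs E {x} \<union> S) t" "(u, w) \<in> E"
    unfolding next_sep_def by (rule coreE)
  then have "u \<in> comp_of E S t" "u \<notin> S"
    using comp_of_next_sep_subset comp_of_disjoint[OF t_notin_nbrs_Un, of E]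
    unfolding comp_of_next_sep by blast+
  with u show "w \<in> S \<union> comp_of E S t" by (auto intro: comp_of_step)
qed

lemma notin_next_sep: "x \<notin> next_sep S x"
proof
  assume "x \<in> next_sep S x"
  then obtain u where "u \<in> comp_of E (next_sep S x) t" "(u, x) \<in> E" "u \<noteq> x"
    unfolding comp_of_next_sep unfolding next_sep_def by (metis coreE)
  then show False using comp_of_next_sep_disjoint_nbrs E_sym by (auto simp: nbrs_def)
qed

lemma comp_of_s_disjoint_next_sep: "comp_of E S s \<inter> next_sep S x = {}"
  using minsep_comp_of_disjoint[OF S] next_sep_subset by blast

lemma comp_of_s_next_sep: "insert x (comp_of E S s) \<subseteq> comp_of E (next_sep S x) s"
proof -
  have sub: "comp_of E S s \<subseteq> comp_of E (next_sep S x) s"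
    by (rule comp_of_mono[OF comp_of_s_disjoint_next_sep])
  moreover obtain y where "y \<in> comp_of E S s" "(y, x) \<in> E" using minsep_nbr_s[OF S x(1)] by blast
  ultimately have "x \<in> comp_of E (next_sep S x) s"
    using notin_next_sep comp_of_s_disjoint_next_sep comp_of_step[of _ E "next_sep S x" s x]
    by blast
  with sub show ?thesis by blast
qed

lemma next_sep_minsep: "is_minsep (next_sep S x)"
proof (rule is_minsep_coreI[OF t_notin_nbrs_Un, folded comp_of_next_sep next_sep_def])
  show "s \<notin> comp_of E (next_sep S x) t"
    using comp_of_next_sep_subset is_minsepD(5)[OF S] by blast
  show "s \<notin> next_sep S x" using comp_of_s_disjoint_next_sep comp_of_self[of s E S] by blast
  fix w assume "w \<in> next_sep S x"
  then have "w \<in> nbrs E {x} \<union> S" using core_subset[OF t_notin_nbrs_Un] by (auto simp: next_sep_def)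
  then show "\<exists>y \<in> comp_of E (next_sep S x) s. (y, w) \<in> E"
    using comp_of_s_next_sep minsep_nbr_s[OF S, of w] by (auto simp: nbrs_def)
qed

end

text \<open>
  A vertex \<open>x \<in> S - T\<close> is not adjacent to the component of \<open>t\<close> in \<open>G - T\<close>, so stepping over \<open>x\<close>
  keeps that component intact.
\<close>

lemma next_sep_towards:
  assumes S: "is_minsep S" and T: "is_minsep T" and sub: "comp_of E T t \<subseteq> comp_of E S t" and "S \<noteq> T"
  obtains x where "x \<in> S" "(x, t) \<notin> E" "comp_of E T t \<subseteq> comp_of E (next_sep S x) t"
proof -
  obtain x where x: "x \<in> S" "x \<notin> T" using minsep_eq[OF S T] \<open>S \<noteq> T\<close> by blast
  note S_disj = minsep_comp_of_disjoint(2)[OF S] and T_disj = minsep_comp_of_disjoint(2)[OF T]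
  have not_nbr: "(u, x) \<notin> E" if "u \<in> comp_of E T t" for u
    using that sub x S_disj T_disj comp_of_step[of u E T t x] by blast
  have xt: "(x, t) \<notin> E" using not_nbr[of t] E_sym by auto
  have "comp_of E T t \<inter> (nbrs E {x} \<union> S) = {}"
    using not_nbr E_sym sub S_disj by (auto simp: nbrs_def)
  then have "comp_of E T t \<subseteq> comp_of E (next_sep S x) t"
    unfolding comp_of_next_sep[OF S x(1) xt] by (rule comp_of_mono)
  with x(1) xt show thesis by (rule that)
qed

lemma relpow_next_rel_minsep:
  assumes "is_minsep S" "(S, T) \<in> next_rel ^^ n"
  shows "is_minsep T"
  using assms(2)
  by (induction n arbitrary: T) (auto simp: assms(1) next_rel_def next_sep_minsep)

lemma ex_relpow_next_rel:
  assumes "is_minsep S" "is_minsep T" "comp_of E T t \<subseteq> comp_of E S t"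
  shows "\<exists>n \<le> card (comp_of E S t). (S, T) \<in> next_rel ^^ n"
  using assms
proof (induction "card (comp_of E S t)" arbitrary: S rule: less_induct)
  case less
  show ?case
  proof (cases "S = T")
    case True
    then show ?thesis by (intro exI[of _ 0]) simp
  next
    case False
    then obtain x where x: "x \<in> S" "(x, t) \<notin> E" "comp_of E T t \<subseteq> comp_of E (next_sep S x) t"
      using next_sep_towards less.prems by metis
    have decreases: "card (comp_of E (next_sep S x) t) < card (comp_of E S t)"
      using comp_of_next_sep_psubset[OF less.prems(1) x(1,2)]
      by (rule psubset_card_mono[OF finite_comp_of_t])
    then obtain n where "n \<le> card (comp_of E (next_sep S x) t)" "(next_sep S x, T) \<in> next_rel ^^ n"
      using less.hyps next_sep_minsep[OF less.prems(1) x(1,2)] less.prems(2) x(3) by blast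
    moreover have "(S, next_sep S x) \<in> next_rel" using x by (auto simp: next_rel_def)
    ultimately show ?thesis
      using decreases by (intro exI[of _ "Suc n"] conjI relpow_Suc_I2) auto
  qed
qed

theorem minseps_eq_relpow: "{S. is_minsep S} = (\<Union>n \<le> card V. (next_rel ^^ n) `` {first_sep})"
proof
  show "(\<Union>n \<le> card V. (next_rel ^^ n) `` {first_sep}) \<subseteq> {S. is_minsep S}"
    using relpow_next_rel_minsep[OF first_sep_minsep] by auto
  show "{S. is_minsep S} \<subseteq> (\<Union>n \<le> card V. (next_rel ^^ n) `` {first_sep})"
  proof
    fix T assume "T \<in> {S. is_minsep S}"
    then obtain n where "n \<le> card (comp_of E first_sep t)" "(first_sep, T) \<in> next_rel ^^ n"
      using ex_relpow_next_rel[OF first_sep_minsep] comp_of_first_sep_maximal by blast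
    moreover have "card (comp_of E first_sep t) \<le> card V"
      by (rule card_mono[OF finite_V comp_of_subset[OF t_V E_subset]])
    ultimately show "T \<in> (\<Union>n \<le> card V. (next_rel ^^ n) `` {first_sep})"
      using order_trans by blast
  qed
qed

end


section \<open>Reconfiguration through minimal separators\<close>

context st_graph
begin

definition sep_step :: "('a set \<Rightarrow> 'a set \<Rightarrow> bool) \<Rightarrow> ('a set \<times> 'a set) set" where
  "sep_step adj = {(X, Y). is_sep X \<and> is_sep Y \<and> adj X Y}"

definition nodes :: "nat \<Rightarrow> 'a set \<Rightarrow> 'a set \<Rightarrow> 'a set set" where
  "nodes k A B = {A, B} \<union> {M. is_minsep M \<and> card M \<le> k}"

definition links :: "nat \<Rightarrow> nat \<Rightarrow> 'a set \<Rightarrow> 'a set \<Rightarrow> ('a set \<times> 'a set) set" where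
  "links k m A B = {(X, Y). X \<in> nodes k A B \<and> Y \<in> nodes k A B \<and> card (X \<union> Y) \<le> m}"

lemma nodes_is_sep: "is_sep A \<Longrightarrow> is_sep B \<Longrightarrow> X \<in> nodes k A B \<Longrightarrow> is_sep X"
  by (auto simp: nodes_def is_minsep_def)

lemma nodes_subset: "A \<subseteq> V \<Longrightarrow> B \<subseteq> V \<Longrightarrow> nodes k A B \<subseteq> Pow V"
  using is_minsepD(2) by (auto simp: nodes_def)

lemma links_subset: "A \<subseteq> V \<Longrightarrow> B \<subseteq> V \<Longrightarrow> links k m A B \<subseteq> Pow V \<times> Pow V"
  using nodes_subset[of A B k] unfolding links_def by blast

lemma links_min_card:
  assumes "A \<subseteq> V" "B \<subseteq> V"
  shows "links (min k (card V)) (min m (card V)) A B = links k m A B"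
proof -
  have nodes: "nodes (min k (card V)) A B = nodes k A B"
    using card_mono[OF finite_V is_minsepD(2)] by (auto simp: nodes_def)
  have "card (X \<union> Y) \<le> card V" if "X \<in> nodes k A B" "Y \<in> nodes k A B" for X Y
    using nodes_subset[OF assms, of k] that by (intro card_mono finite_V) auto
  then show ?thesis unfolding links_def nodes by auto
qed

lemma reconfiguration_imp_links:
  assumes A: "is_sep A" "card A \<le> k" and B: "is_sep B" "card B \<le> k" and km: "k \<le> m"
    and adj: "\<And>X Y. is_sep X \<Longrightarrow> is_sep Y \<Longrightarrow> card X \<le> k \<Longrightarrow> adj X Y \<Longrightarrow> card Y \<le> k \<and> card (X \<union> Y) \<le> m"
    and path: "(A, B) \<in> (sep_step adj)\<^sup>*"
  shows "(A, B) \<in> (links k m A B)\<^sup>*"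
proof -
  have node: "M \<in> nodes k A B" if "is_minsep M" "M \<subseteq> S" "is_sep S" "card S \<le> k" for M S
    using that card_mono[OF is_sep_finite[of S] \<open>M \<subseteq> S\<close>] by (auto simp: nodes_def)
  have "is_sep S \<and> card S \<le> k \<and> (\<forall>M. is_minsep M \<longrightarrow> M \<subseteq> S \<longrightarrow> (A, M) \<in> (links k m A B)\<^sup>*)"
    if "(A, S) \<in> (sep_step adj)\<^sup>*" for S
    using that
  proof (induction rule: rtrancl_induct)
    case base
    have "(A, M) \<in> links k m A B" if "is_minsep M" "M \<subseteq> A" for M
      using that A km node[OF that A] by (auto simp: links_def nodes_def Un_absorb2)
    then show ?case using A by blast
  next
    case (step S S')
    have S: "is_sep S" "is_sep S'" "card S \<le> k" "card S' \<le> k" "card (S \<union> S') \<le> m"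
      using step adj[of S S'] by (auto simp: sep_step_def)
    obtain M where M: "is_minsep M" "M \<subseteq> S" using ex_minsep_subset[OF S(1)] by blast
    have "(A, M') \<in> (links k m A B)\<^sup>*" if M': "is_minsep M'" "M' \<subseteq> S'" for M'
    proof -
      have "card (M \<union> M') \<le> card (S \<union> S')"
        using M M' S is_sep_finite by (intro card_mono) auto
      then have "(M, M') \<in> links k m A B"
        using S M M' node by (auto simp: links_def)
      then show ?thesis using step.IH M by (meson rtrancl.rtrancl_into_rtrancl)
    qed
    then show ?case using S by blast
  qed
  moreover obtain M where M: "is_minsep M" "M \<subseteq> B" using ex_minsep_subset[OF B(1)] by blast
  ultimately have "(A, M) \<in> (links k m A B)\<^sup>*" using path by blast
  moreover have "(M, B) \<in> links k m A B"
    using M B km node[OF M B] by (auto simp: links_def nodes_def Un_absorb1)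
  ultimately show ?thesis by (rule rtrancl_into_rtrancl)
qed


subsection \<open>Token addition and removal\<close>

lemma sym_sep_step_tar: "sym (sep_step (tar_adjacent k))"
  by (auto simp: sym_def sep_step_def tar_adjacent_def Un_commute max.commute)

lemma tar_adjacent_imp_subset:
  assumes "tar_adjacent k X Y" shows "X \<subseteq> Y \<or> Y \<subseteq> X"
proof -
  obtain z where "sym_diff X Y = {z}"
    using assms by (auto simp: tar_adjacent_def card_1_singleton_iff)
  then have "X - Y = {} \<or> Y - X = {}" unfolding Un_singleton_iff by blast
  then show ?thesis by blast
qed

lemma sep_step_tar_superset:
  assumes X: "is_sep X" and Z: "is_sep Z" "X \<subseteq> Z" "card Z \<le> k"
  shows "(X, Z) \<in> (sep_step (tar_adjacent k))\<^sup>*"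
proof -
  have fin: "finite Z" using is_sep_finite Z by blast
  have "(X, X \<union> W) \<in> (sep_step (tar_adjacent k))\<^sup>*" if "finite W" "W \<subseteq> Z - X" for W
    using that
  proof (induction W rule: finite_induct)
    case (insert w W)
    have "sym_diff (X \<union> W) (X \<union> insert w W) = {w}" using insert by auto
    moreover have "card (X \<union> W) \<le> card Z" "card (X \<union> insert w W) \<le> card Z"
      using insert Z fin by (auto intro!: card_mono)
    moreover have "is_sep (X \<union> W)" "is_sep (X \<union> insert w W)"
      using insert Z by (auto intro!: is_sep_superset[OF X] dest: is_sep_subset)
    ultimately have "(X \<union> W, X \<union> insert w W) \<in> sep_step (tar_adjacent k)"
      using Z by (auto simp: sep_step_def tar_adjacent_def)
    then show ?case using insert by (auto intro: rtrancl_into_rtrancl)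
  qed simp
  from this[of "Z - X"] show ?thesis using fin Z by (simp add: Un_absorb1)
qed

theorem tar_iff_links:
  assumes A: "is_sep A" "card A \<le> k" and B: "is_sep B" "card B \<le> k"
  shows "(A, B) \<in> (sep_step (tar_adjacent k))\<^sup>* \<longleftrightarrow> (A, B) \<in> (links k k A B)\<^sup>*"
proof
  assume "(A, B) \<in> (sep_step (tar_adjacent k))\<^sup>*"
  then show "(A, B) \<in> (links k k A B)\<^sup>*"
  proof (rule reconfiguration_imp_links[OF A B order_refl, rotated])
    show "card Y \<le> k \<and> card (X \<union> Y) \<le> k" if "tar_adjacent k X Y" for X Y
      using that tar_adjacent_imp_subset[OF that]
      by (auto simp: tar_adjacent_def Un_absorb1 Un_absorb2)
  qed
next
  assume "(A, B) \<in> (links k k A B)\<^sup>*"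
  then show "(A, B) \<in> (sep_step (tar_adjacent k))\<^sup>*"
  proof (induction rule: rtrancl_induct)
    case (step X Y)
    have XY: "is_sep X" "is_sep Y" "card (X \<union> Y) \<le> k"
      using step nodes_is_sep[OF A(1) B(1)] by (auto simp: links_def)
    have "(X, X \<union> Y) \<in> (sep_step (tar_adjacent k))\<^sup>*" "(Y, X \<union> Y) \<in> (sep_step (tar_adjacent k))\<^sup>*"
      using XY is_sep_Un by (auto intro!: sep_step_tar_superset)
    then have "(X, Y) \<in> (sep_step (tar_adjacent k))\<^sup>*"
      using sym_rtrancl[OF sym_sep_step_tar] by (meson rtrancl_trans symD)
    then show ?case using step by (meson rtrancl_trans)
  qed simp
qed


subsection \<open>Token jumping\<close>

lemma card_Un_tj_adjacent_le: "tj_adjacent X Y \<Longrightarrow> card (X \<union> Y) \<le> card X + 1"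
  using card_Un_le[of X "Y - X"] unfolding tj_adjacent_def by simp

lemma sep_step_tj_common_subset:
  assumes X: "is_sep X" and "X \<subseteq> P" "P \<subseteq> V - {s, t}" "X \<subseteq> Q" "Q \<subseteq> V - {s, t}"
    and "card P = card Q"
  shows "(P, Q) \<in> (sep_step tj_adjacent)\<^sup>*"
  using assms(2-)
proof (induction "card (P - Q)" arbitrary: P)
  case 0
  have "finite P" "finite Q" using 0 finite_V by (auto intro: finite_subset)
  then have "P = Q" using 0 by (simp add: card_subset_eq)
  then show ?case by simp
next
  case (Suc n)
  have fin: "finite P" "finite Q" using Suc.prems finite_V by (auto intro: finite_subset)
  obtain p where p: "p \<in> P" "p \<notin> Q"
    using Suc.hyps(2) by (metis Diff_eq_empty_iff card.empty nat.simps(3) subsetI)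
  have "\<not> Q \<subseteq> P" using p Suc.prems fin by (metis card_subset_eq)
  then obtain q where q: "q \<in> Q" "q \<notin> P" by blast
  define P' where "P' = insert q (P - {p})"
  have card: "card P' = card P"
    using p q fin by (metis P'_def Diff_iff card.insert card.remove finite_Diff)
  have sub: "X \<subseteq> P'" "P' \<subseteq> V - {s, t}" using p q Suc.prems by (auto simp: P'_def)
  have "P - P' = {p}" "P' - P = {q}" using p q by (auto simp: P'_def)
  then have "(P, P') \<in> sep_step tj_adjacent"
    using card sub Suc.prems is_sep_superset[OF X] by (auto simp: sep_step_def tj_adjacent_def)
  moreover have "(P', Q) \<in> (sep_step tj_adjacent)\<^sup>*"
  proof (rule Suc.hyps(1))
    have "P' - Q = (P - Q) - {p}" using p q by (auto simp: P'_def)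
    then show "n = card (P' - Q)" using Suc.hyps(2) p fin by simp
  qed (use sub card Suc.prems in auto)
  ultimately show ?case by (rule converse_rtrancl_into_rtrancl)
qed

lemma sep_step_tj_between_supersets:
  assumes X: "is_sep X" "card X \<le> k" and Y: "is_sep Y" "card Y \<le> k"
    and XY: "card (X \<union> Y) \<le> k + 1" and k: "k \<le> card (V - {s, t})"
  obtains P Q where "X \<subseteq> P" "P \<subseteq> V - {s, t}" "card P = k" "Y \<subseteq> Q" "Q \<subseteq> V - {s, t}" "card Q = k"
    "(P, Q) \<in> (sep_step tj_adjacent)\<^sup>*"
proof (cases "card (X \<union> Y) \<le> k")
  case True
  moreover have "X \<union> Y \<subseteq> V - {s, t}" using X Y is_sep_subset by blast
  ultimately obtain W where "X \<union> Y \<subseteq> W" "W \<subseteq> V - {s, t}" "card W = k"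
    using exists_subset_between[OF _ k] finite_V by blast
  then show thesis using that[of W W] by blast
next
  case False
  let ?W = "X \<union> Y"
  have W: "card ?W = k + 1" "finite ?W" using False XY X Y is_sep_finite by auto
  have "?W \<noteq> X" "?W \<noteq> Y" using W(1) X(2) Y(2) by force+
  then obtain x y where x: "x \<in> X" "x \<notin> Y" and y: "y \<in> Y" "y \<notin> X" by blast
  have cards: "card (?W - {y}) = k" "card (?W - {x}) = k" using x y W by auto
  have subsets: "?W - {y} \<subseteq> V - {s, t}" "?W - {x} \<subseteq> V - {s, t}" "X \<subseteq> ?W - {y}" "Y \<subseteq> ?W - {x}"
    using X Y x y is_sep_subset by blast+
  have "(?W - {y}) - (?W - {x}) = {x}" "(?W - {x}) - (?W - {y}) = {y}" using x y by auto
  then have "(?W - {y}, ?W - {x}) \<in> sep_step tj_adjacent"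
    using cards subsets is_sep_superset[OF X(1)] is_sep_superset[OF Y(1)]
    by (simp add: sep_step_def tj_adjacent_def)
  then show thesis using that[of "?W - {y}" "?W - {x}"] subsets cards by blast
qed

theorem tj_iff_links:
  assumes A: "is_sep A" "card A = k" and B: "is_sep B" "card B = k"
  shows "(A, B) \<in> (sep_step tj_adjacent)\<^sup>* \<longleftrightarrow> (A, B) \<in> (links k (k + 1) A B)\<^sup>*"
proof
  assume "(A, B) \<in> (sep_step tj_adjacent)\<^sup>*"
  then show "(A, B) \<in> (links k (k + 1) A B)\<^sup>*"
  proof (rule reconfiguration_imp_links[rotated -1])
    show "card Y \<le> k \<and> card (X \<union> Y) \<le> k + 1" if "card X \<le> k" "tj_adjacent X Y" for X Y
      using that card_Un_tj_adjacent_le[OF that(2)] by (auto simp: tj_adjacent_def)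
  qed (use A B in auto)
next
  let ?U = "V - {s, t}"
  let ?R = "(sep_step tj_adjacent)\<^sup>*"
  have k: "k \<le> card ?U" using A card_mono[OF _ is_sep_subset[OF A(1)]] finite_V by simp
  assume "(A, B) \<in> (links k (k + 1) A B)\<^sup>*"
  then have "\<forall>Q. B \<subseteq> Q \<longrightarrow> Q \<subseteq> ?U \<longrightarrow> card Q = k \<longrightarrow> (A, Q) \<in> ?R"
  proof (induction rule: rtrancl_induct)
    case base
    have "Q = A" if "A \<subseteq> Q" "Q \<subseteq> ?U" "card Q = k" for Q
      using that A finite_V by (metis card_subset_eq finite_Diff finite_subset)
    then show ?case by blast
  next
    case (step X Y)
    have X: "is_sep X" "card X \<le> k" and Y: "is_sep Y" "card Y \<le> k" and XY: "card (X \<union> Y) \<le> k + 1"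
      using step(2) nodes_is_sep[OF A(1) B(1)] A(2) B(2) by (auto simp: links_def nodes_def)
    obtain P Q where P: "X \<subseteq> P" "P \<subseteq> ?U" "card P = k" and Q: "Y \<subseteq> Q" "Q \<subseteq> ?U" "card Q = k"
      and PQ: "(P, Q) \<in> ?R"
      using sep_step_tj_between_supersets[OF X Y XY k] .
    have "(A, Q') \<in> ?R" if Q': "Y \<subseteq> Q'" "Q' \<subseteq> ?U" "card Q' = k" for Q'
    proof -
      have "(A, P) \<in> ?R" using step.IH P by blast
      moreover have "(Q, Q') \<in> ?R"
        using sep_step_tj_common_subset[OF Y(1) Q(1,2) Q'(1,2)] Q Q' by simp
      ultimately show ?thesis using PQ by (meson rtrancl_trans)
    qed
    then show ?case by blast
  qed
  then show "(A, B) \<in> ?R" using B is_sep_subset by blast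
qed

end


subsection \<open>Separators of pair graphs\<close>

lemma verts_del_verts: "verts (del_verts G S) = pverts G - S"
  by (simp add: del_verts_def)

lemma (in pair_graph) sym_parcs: "sym (parcs G)"
  using sym_arcs by (simp add: symmetric_def arcs_ends_conv)

lemma (in pair_graph) parcs_subset: "parcs G \<subseteq> pverts G \<times> pverts G"
  using in_arcsD1 in_arcsD2 by auto

lemma (in pair_graph) arcs_ends_del_verts: "arcs_ends (del_verts G S) = avoiding (parcs G) S"
  using parcs_subset by (auto simp: del_verts_def arcs_ends_conv avoiding_def image_iff)

lemma (in wf_digraph) distinct_sccs_iff:
  assumes "symmetric G"
  shows "(\<exists>C \<in> sccs_verts. \<exists>D \<in> sccs_verts. x \<in> C \<and> y \<in> D \<and> C \<noteq> D) \<longleftrightarrow>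
    x \<in> verts G \<and> y \<in> verts G \<and> \<not> y \<rightarrow>\<^sup>* x"
proof
  assume "\<exists>C \<in> sccs_verts. \<exists>D \<in> sccs_verts. x \<in> C \<and> y \<in> D \<and> C \<noteq> D"
  then obtain C D where CD: "C \<in> sccs_verts" "D \<in> sccs_verts" "x \<in> C" "y \<in> D" "C \<noteq> D" by blast
  have "\<not> y \<rightarrow>\<^sup>* x"
  proof
    assume "y \<rightarrow>\<^sup>* x"
    moreover from this have "x \<rightarrow>\<^sup>* y" by (rule symmetric_reachable[OF assms])
    ultimately have "x \<in> D" using CD unfolding in_sccs_verts_conv_reachable by blast
    then show False using CD sccs_verts_disjoint by blast
  qed
  then show "x \<in> verts G \<and> y \<in> verts G \<and> \<not> y \<rightarrow>\<^sup>* x"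
    using CD sccs_verts_subsets by blast
next
  assume xy: "x \<in> verts G \<and> y \<in> verts G \<and> \<not> y \<rightarrow>\<^sup>* x"
  then have "scc_of x \<noteq> scc_of y" "x \<in> scc_of x" "y \<in> scc_of y"
    using in_scc_of_self by (auto simp: scc_of_def)
  then show "\<exists>C \<in> sccs_verts. \<exists>D \<in> sccs_verts. x \<in> C \<and> y \<in> D \<and> C \<noteq> D"
    using xy scc_of_in_sccs_verts by blast
qed

lemma (in pair_graph) separator_iff:
  "separator G x y S \<longleftrightarrow> S \<subseteq> pverts G - {x, y} \<and> x \<in> pverts G \<and> y \<in> pverts G \<and>
    x \<notin> comp_of (parcs G) S y"
proof (cases "S \<subseteq> pverts G - {x, y}")
  case True
  interpret H: wf_digraph "del_verts G S"
    unfolding del_verts_def by (rule wellformed_induce_subgraph)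
  have sym: "symmetric (del_verts G S)"
    using sym_parcs by (auto simp: symmetric_def arcs_ends_del_verts avoiding_def sym_def)
  have "separator G x y S \<longleftrightarrow>
      x \<in> pverts G - S \<and> y \<in> pverts G - S \<and> \<not> y \<rightarrow>\<^sup>*\<^bsub>del_verts G S\<^esub> x"
    using True unfolding separator_def components_def H.distinct_sccs_iff[OF sym] verts_del_verts
    by simp
  also have "\<dots> \<longleftrightarrow> x \<in> pverts G \<and> y \<in> pverts G \<and> x \<notin> comp_of (parcs G) S y"
    using True by (auto simp: H.reachable_conv arcs_ends_del_verts verts_del_verts comp_of_def)
  finally show ?thesis using True by simp
qed (auto simp: separator_def)

lemma (in pair_graph) finite_minimal_vertex_separators: "finite (minimal_vertex_separators G)"
  by (rule finite_subset[of _ "Pow (pverts G)"])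
    (auto simp: minimal_vertex_separators_def minimal_separator_def separator_def)

locale nonadjacent_pair = pair_graph G for G :: "'a pair_pre_digraph" +
  fixes s t :: 'a
  assumes nonadjacent: "nonadjacent G s t"

lemmas nonadjacent_pairI = nonadjacent_pair.intro[OF _ nonadjacent_pair_axioms.intro]

sublocale nonadjacent_pair \<subseteq> st_graph "pverts G" "parcs G" s t
  using nonadjacent parcs_subset sym_parcs by unfold_locales (auto simp: nonadjacent_def)

context nonadjacent_pair
begin

lemma separator_eq_is_sep: "separator G s t = is_sep"
  using s_V t_V by (auto simp: fun_eq_iff separator_iff is_sep_def)

lemma minseps_subset: "{S. is_minsep S} \<subseteq> minimal_vertex_separators G"
proof -
  have "is_minsep = minimal_separator G s t"
    by (simp add: fun_eq_iff minimal_separator_def separator_eq_is_sep is_minsep_def)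
  then show ?thesis using nonadjacent by (auto simp: minimal_vertex_separators_def)
qed

lemma reconfigurable_iff_sep_step:
  "reconfigurable adj G s t A B \<longleftrightarrow> is_sep A \<and> (A, B) \<in> (sep_step adj)\<^sup>*"
  unfolding reconfigurable_def separator_eq_is_sep successively_iff_rtrancl sep_step_def ..

end


subsection \<open>Relabelling vertices\<close>

lemma comp_of_map_prod:
  assumes "inj h"
  shows "comp_of (map_prod h h ` E) (h ` X) (h t) = h ` comp_of E X t"
proof
  show "comp_of (map_prod h h ` E) (h ` X) (h t) \<subseteq> h ` comp_of E X t"
    by (rule comp_of_least)
      (use assms in \<open>auto simp: inj_eq inj_image_mem_iff intro: comp_of_step\<close>)
  have "comp_of E X t \<subseteq> {u. h u \<in> comp_of (map_prod h h ` E) (h ` X) (h t)}"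
  proof (rule comp_of_least)
    fix u w assume "u \<in> {u. h u \<in> comp_of (map_prod h h ` E) (h ` X) (h t)}"
      and "(u, w) \<in> E" "u \<notin> X" "w \<notin> X"
    then show "w \<in> {u. h u \<in> comp_of (map_prod h h ` E) (h ` X) (h t)}"
      using comp_of_step[of "h u" "map_prod h h ` E" "h ` X" "h t" "h w"] assms
      by (auto simp: inj_image_mem_iff)
  qed simp
  then show "h ` comp_of E X t \<subseteq> comp_of (map_prod h h ` E) (h ` X) (h t)" by blast
qed

locale st_graph_image = st_graph V E s t
  for V :: "'a set" and E s t +
  fixes h :: "'a \<Rightarrow> 'b"
  assumes inj_h: "inj h"

sublocale st_graph_image \<subseteq> img: st_graph "h ` V" "map_prod h h ` E" "h s" "h t"
proof
  show "sym (map_prod h h ` E)" using E_sym by (fastforce intro: symI)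
  show "map_prod h h ` E \<subseteq> h ` V \<times> h ` V" using E_subset by auto
qed (use finite_V s_V t_V s_neq_t not_adj inj_h in \<open>auto dest: injD\<close>)

context st_graph_image
begin

lemma card_image_h: "card (h ` S) = card S"
  by (rule card_image[OF inj_on_subset[OF inj_h subset_UNIV]])

lemma is_sep_image_iff: "img.is_sep (h ` S) \<longleftrightarrow> is_sep S"
  unfolding img.is_sep_def is_sep_def comp_of_map_prod[OF inj_h]
  using inj_h by (auto simp: inj_image_mem_iff image_subset_iff inj_eq)

lemma minseps_image: "{S. img.is_minsep S} = image h ` {S. is_minsep S}"
proof -
  have iff: "img.is_minsep (h ` S) \<longleftrightarrow> is_minsep S" for S
    unfolding img.is_minsep_def is_minsep_def is_sep_image_iff
    by (metis (no_types, opaque_lifting) is_sep_image_iff subset_image_iff psubset_eq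
        inj_h inj_image_eq_iff inj_image_subset_iff)
  have "\<exists>S. T = h ` S" if "img.is_minsep T" for T
    using img.is_minsepD(2)[OF that] by (auto simp: subset_image_iff)
  then show ?thesis using iff by (auto simp: image_iff) metis
qed

lemma nodes_image: "img.nodes k (h ` A) (h ` B) = image h ` nodes k A B"
proof -
  have "{M. img.is_minsep M \<and> card M \<le> k} = {M \<in> image h ` {S. is_minsep S}. card M \<le> k}"
    by (simp flip: minseps_image)
  also have "\<dots> = image h ` {M. is_minsep M \<and> card M \<le> k}" by (auto simp: card_image_h)
  finally have "{M. img.is_minsep M \<and> card M \<le> k} = image h ` {M. is_minsep M \<and> card M \<le> k}" .
  then show ?thesis by (simp add: img.nodes_def nodes_def)
qed

lemma links_image: "img.links k m (h ` A) (h ` B) = map_prod (image h) (image h) ` links k m A B"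
  unfolding img.links_def links_def nodes_image by (auto simp: card_image_h simp flip: image_Un)

lemma rtrancl_links_image_iff:
  "(h ` A, h ` B) \<in> (img.links k m (h ` A) (h ` B))\<^sup>* \<longleftrightarrow> (A, B) \<in> (links k m A B)\<^sup>*"
  unfolding links_image by (rule rtrancl_map_prod_iff[OF inj_on_image_Pow[OF inj_h]]) auto

end


section \<open>The algorithm on lists of trees\<close>

subsection \<open>Reachability and separators\<close>

definition arcs_of :: "data list \<Rightarrow> (data \<times> data) set" where
  "arcs_of es = (\<lambda>p. (left p, right p)) ` set es"

definition nbr_list :: "data list \<Rightarrow> data list \<Rightarrow> data list" where
  "nbr_list es C = map right (filter (\<lambda>p. left p \<in> set C \<and> right p \<notin> set C) es)"

definition avoid_list :: "data list \<Rightarrow> data list \<Rightarrow> data list" where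
  "avoid_list es X = filter (\<lambda>p. left p \<notin> set X \<and> right p \<notin> set X) es"

definition spread :: "data list \<Rightarrow> data \<Rightarrow> data list \<Rightarrow> data list" where
  "spread es t R =
     filter (\<lambda>x. x \<in> set R \<or> (\<exists>p \<in> set es. left p \<in> set R \<and> right p = x)) (t # map right es)"

definition reach_list :: "data list \<Rightarrow> data \<Rightarrow> data list" where
  "reach_list es t = (spread es t ^^ length es) [t]"

text \<open>
  Filtering \<open>v\<close> gives a subset of \<open>set v\<close> a unique code, so sets of vertices are compared as trees.
\<close>

definition code :: "data list \<Rightarrow> data set \<Rightarrow> data" where
  "code v S = dlist (filter (\<lambda>x. x \<in> S) v)"

definition core_code :: "data list \<Rightarrow> data list \<Rightarrow> data \<Rightarrow> data list \<Rightarrow> data" where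
  "core_code v es t X = code v (set (nbr_list es (reach_list (avoid_list es X) t)))"

definition next_code :: "data list \<Rightarrow> data list \<Rightarrow> data \<Rightarrow> data \<Rightarrow> data \<Rightarrow> data" where
  "next_code v es t S x = core_code v es t (nbr_list es [x] @ elems S)"

definition next_round :: "data list \<Rightarrow> data list \<Rightarrow> data \<Rightarrow> data list \<Rightarrow> data list" where
  "next_round v es t L = remdups (L @ concat (map (\<lambda>S. map (next_code v es t S)
     (filter (\<lambda>x. \<not> (\<exists>p \<in> set es. left p = x \<and> right p = t)) (elems S))) L))"

definition first_round :: "data list \<Rightarrow> data list \<Rightarrow> data \<Rightarrow> data \<Rightarrow> data list" where
  "first_round v es s t = [core_code v es t (nbr_list es [s])]"

definition minsep_list :: "data list \<Rightarrow> data list \<Rightarrow> data \<Rightarrow> data \<Rightarrow> data list" where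
  "minsep_list v es s t = (next_round v es t ^^ length v) (first_round v es s t)"

definition link_list :: "data list \<Rightarrow> nat \<Rightarrow> data list \<Rightarrow> data list" where
  "link_list v m L = concat (map (\<lambda>X. map (\<lambda>Y. Pair X Y)
     (filter (\<lambda>Y. length (filter (\<lambda>x. x \<in> dset X \<or> x \<in> dset Y) v) \<le> m) L)) L)"

definition decide_links ::
  "data list \<Rightarrow> data list \<Rightarrow> data \<Rightarrow> data \<Rightarrow> data list \<Rightarrow> data list \<Rightarrow> nat \<Rightarrow> nat \<Rightarrow> bool"
where
  "decide_links v es s t A B k m \<longleftrightarrow> code v (set B) \<in> set (reach_list
     (link_list v m (code v (set A) # code v (set B) #
       filter (\<lambda>S. length (elems S) \<le> k) (minsep_list v es s t)))
     (code v (set A)))"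


subsection \<open>Running time\<close>

lemma ptime_nbr_list:
  assumes "ptime_list D es" "ptime_list D C"
  shows "ptime_list D (\<lambda>d. nbr_list (es d) (C d))"
  unfolding nbr_list_def by (intro ptime_intros assms)

lemma ptime_avoid_list:
  assumes "ptime_list D es" "ptime_list D X"
  shows "ptime_list D (\<lambda>d. avoid_list (es d) (X d))"
  unfolding avoid_list_def by (intro ptime_intros assms)

lemma ptime_spread:
  assumes "ptime_list D es" "ptime D t" "ptime_list D R"
  shows "ptime_list D (\<lambda>d. spread (es d) (t d) (R d))"
  unfolding spread_def by (intro ptime_intros assms)

lemma size_spread_funpow_le:
  "size (dlist ((spread es t ^^ i) [t])) \<le> size (dlist (t # map right es))"
  using size_dlist_filter_le[of _ "t # map right es"]
  by (cases i) (simp_all add: spread_def del: filter.simps)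

lemma ptime_reach_list:
  assumes "ptime_list D es" "ptime D t"
  shows "ptime_list D (\<lambda>d. reach_list (es d) (t d))"
  unfolding reach_list_def
proof (rule ptime_list_funpow[OF _ _ _ _ size_spread_funpow_le])
  show "poly_bounded D (\<lambda>d. size (dlist (t d # map right (es d))))"
    by (intro poly_bounded_ptime ptime_intros assms)
qed (intro ptime_spread ptime_intros assms)+

lemma ptime_code:
  assumes "ptime_list D v" "ptime_list D X"
  shows "ptime D (\<lambda>d. code (v d) (set (X d)))"
  unfolding code_def by (intro ptime_intros assms)

lemma ptime_core_code:
  assumes "ptime_list D v" "ptime_list D es" "ptime D t" "ptime_list D X"
  shows "ptime D (\<lambda>d. core_code (v d) (es d) (t d) (X d))"
  unfolding core_code_def
  by (intro ptime_code ptime_nbr_list ptime_reach_list ptime_avoid_list assms)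

lemma ptime_next_code:
  assumes "ptime_list D v" "ptime_list D es" "ptime D t" "ptime D S" "ptime D x"
  shows "ptime D (\<lambda>d. next_code (v d) (es d) (t d) (S d) (x d))"
  unfolding next_code_def by (intro ptime_core_code ptime_nbr_list ptime_intros assms)

lemma ptime_next_round:
  assumes "ptime_list D v" "ptime_list D es" "ptime D t" "ptime_list D L"
  shows "ptime_list D (\<lambda>d. next_round (v d) (es d) (t d) (L d))"
  unfolding next_round_def by (intro ptime_next_code ptime_intros assms)

lemma ptime_link_list:
  assumes "ptime_list D v" "ptime_nat D m" "ptime_list D L"
  shows "ptime_list D (\<lambda>d. link_list (v d) (m d) (L d))"
  unfolding link_list_def by (intro ptime_intros assms)

lemma ptime_decide_links:
  assumes "ptime_list D (\<lambda>d. minsep_list (v d) (es d) (s d) (t d))" "ptime_list D v"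
    and "ptime_list D A" "ptime_list D B" "ptime_nat D k" "ptime_nat D m"
  shows "ptime_pred D (\<lambda>d. decide_links (v d) (es d) (s d) (t d) (A d) (B d) (k d) (m d))"
  unfolding decide_links_def
  by (intro ptime_reach_list ptime_link_list ptime_code ptime_intros assms)


subsection \<open>Correctness\<close>

lemma mem_arcs_of [simp]: "(x, y) \<in> arcs_of es \<longleftrightarrow> (\<exists>p \<in> set es. left p = x \<and> right p = y)"
  by (auto simp: arcs_of_def)

lemma Image_arcs_of: "arcs_of es `` R = {y. \<exists>p \<in> set es. left p \<in> R \<and> right p = y}"
  by (auto simp: Image_def)

lemma finite_arcs_of: "finite (arcs_of es)" and card_arcs_of_le: "card (arcs_of es) \<le> length es"
  unfolding arcs_of_def by (simp, meson card_image_le card_length finite_set order_trans)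

lemma set_nbr_list [simp]: "set (nbr_list es C) = nbrs (arcs_of es) (set C)"
  by (auto simp: nbr_list_def nbrs_def Image_arcs_of)

lemma arcs_of_avoid_list [simp]: "arcs_of (avoid_list es X) = avoiding (arcs_of es) (set X)"
  by (auto simp: avoid_list_def avoiding_def)

lemma set_spread:
  "set R \<subseteq> insert t (right ` set es) \<Longrightarrow> set (spread es t R) = set R \<union> arcs_of es `` set R"
  by (auto simp: spread_def Image_arcs_of)

lemma set_reach_list [simp]: "set (reach_list es t) = (arcs_of es)\<^sup>* `` {t}"
proof -
  have "set ((spread es t ^^ n) [t]) = ((\<lambda>X. X \<union> arcs_of es `` X) ^^ n) {t}" for n
  proof (induction n)
    case (Suc n)
    have "set ((spread es t ^^ n) [t]) \<subseteq> insert t (right ` set es)"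
      by (cases n) (auto simp: spread_def)
    from set_spread[OF this] Suc show ?case by simp
  qed simp
  then have "set (reach_list es t) = (\<Union>i \<le> length es. (arcs_of es ^^ i) `` {t})"
    unfolding reach_list_def funpow_Un_Image .
  also have "\<dots> = (arcs_of es)\<^sup>* `` {t}"
  proof
    show "(\<Union>i \<le> length es. (arcs_of es ^^ i) `` {t}) \<subseteq> (arcs_of es)\<^sup>* `` {t}"
      by (auto dest: relpow_imp_rtrancl)
    show "(arcs_of es)\<^sup>* `` {t} \<subseteq> (\<Union>i \<le> length es. (arcs_of es ^^ i) `` {t})"
      unfolding rtrancl_finite_eq_relpow[OF finite_arcs_of]
      using card_arcs_of_le[of es] order_trans by fastforce
  qed
  finally show ?thesis .
qed

lemma core_code_eq: "core_code v es t X = code v (core (arcs_of es) t (set X))"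
  by (simp add: core_code_def core_def comp_of_def)

lemma dset_code: "S \<subseteq> set v \<Longrightarrow> dset (code v S) = S"
  by (auto simp: code_def)

lemma inj_on_code: "inj_on (code v) (Pow (set v))"
  by (rule inj_on_inverseI[where g = dset]) (simp add: dset_code)

lemma size_code_le: "size (code v S) \<le> size (dlist v)"
  unfolding code_def by (rule size_dlist_filter_le)

lemma next_code_eq:
  "S \<subseteq> set v \<Longrightarrow> next_code v es t (code v S) x =
     code v (core (arcs_of es) t (nbrs (arcs_of es) {x} \<union> S))"
  by (simp add: next_code_def core_code_eq dset_code)

locale listed_graph = st_graph "set v" "arcs_of es" s t
  for v es :: "data list" and s t :: data +
  assumes distinct_v: "distinct v"
begin

lemma length_filter_v: "length (filter (\<lambda>x. x \<in> S) v) = card (S \<inter> set v)"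
  using distinct_card[OF distinct_filter[OF distinct_v]] by (simp add: Int_def conj_commute)

lemma length_code: "S \<subseteq> set v \<Longrightarrow> length (elems (code v S)) = card S"
  by (simp add: code_def length_filter_v Int_absorb2)

lemma set_next_round:
  assumes L: "set L = code v ` M" and M: "M \<subseteq> {S. is_minsep S}"
  shows "set (next_round v es t L) = code v ` (M \<union> next_rel `` M)"
proof -
  have "set (map (next_code v es t (code v S))
      (filter (\<lambda>x. \<not> (\<exists>p \<in> set es. left p = x \<and> right p = t)) (elems (code v S)))) =
    code v ` (next_rel `` {S})" if "S \<in> M" for S
  proof -
    have "S \<subseteq> set v" using that M is_minsepD(2) by blast
    then show ?thesis
      by (auto simp: next_rel_def next_sep_def next_code_eq dset_code)
  qed
  then have "set (next_round v es t L) = code v ` M \<union> (\<Union>S \<in> M. code v ` (next_rel `` {S}))"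
    by (simp add: next_round_def L)
  then show ?thesis by blast
qed

lemma set_next_round_funpow:
  "set ((next_round v es t ^^ n) (first_round v es s t)) =
     code v ` (\<Union>i \<le> n. (next_rel ^^ i) `` {first_sep})"
  unfolding funpow_Un_Image[symmetric]
proof (induction n)
  case 0
  show ?case by (simp add: first_round_def core_code_eq first_sep_def)
next
  case (Suc n)
  have "((\<lambda>X. X \<union> next_rel `` X) ^^ n) {first_sep} \<subseteq> {S. is_minsep S}"
    unfolding funpow_Un_Image using relpow_next_rel_minsep[OF first_sep_minsep] by auto
  from set_next_round[OF Suc this] show ?case by simp
qed

lemma distinct_next_round_funpow: "distinct ((next_round v es t ^^ n) (first_round v es s t))"
  by (cases n) (simp_all add: first_round_def next_round_def)

lemma set_minsep_list: "set (minsep_list v es s t) = code v ` {S. is_minsep S}"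
  unfolding minsep_list_def set_next_round_funpow minseps_eq_relpow distinct_card[OF distinct_v] ..

lemma size_next_round_funpow_le:
  "size (dlist ((next_round v es t ^^ n) (first_round v es s t)))
     \<le> card {S. is_minsep S} * (size (dlist v) + 1)"
proof -
  let ?L = "(next_round v es t ^^ n) (first_round v es s t)"
  have "set ?L \<subseteq> code v ` {S. is_minsep S}"
    unfolding set_next_round_funpow using relpow_next_rel_minsep[OF first_sep_minsep] by auto
  then have "card (set ?L) \<le> card {S. is_minsep S}"
    by (meson card_image_le card_mono finite_imageI finite_minseps order_trans)
  then have "length ?L \<le> card {S. is_minsep S}"
    by (simp add: distinct_card[OF distinct_next_round_funpow])
  moreover have "size (dlist ?L) \<le> length ?L * (size (dlist v) + 1)"
    by (rule size_dlist_le) (auto simp: set_next_round_funpow size_code_le)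
  ultimately show ?thesis by (meson mult_le_mono1 order_trans)
qed

lemma arcs_of_link_list:
  assumes L: "set L = code v ` N" and N: "N \<subseteq> Pow (set v)"
  shows "arcs_of (link_list v m L) =
    map_prod (code v) (code v) ` {(X, Y). X \<in> N \<and> Y \<in> N \<and> card (X \<union> Y) \<le> m}"
proof -
  have card: "length (filter (\<lambda>x. x \<in> dset (code v X) \<or> x \<in> dset (code v Y)) v) = card (X \<union> Y)"
    if "X \<in> N" "Y \<in> N" for X Y
  proof -
    have "X \<subseteq> set v" "Y \<subseteq> set v" using that N by auto
    then show ?thesis using length_filter_v[of "X \<union> Y"] by (simp add: dset_code Int_absorb2)
  qed
  show ?thesis
    unfolding arcs_of_def link_list_def by (force simp: L card)
qed

lemma decide_links_iff:
  assumes A: "set A \<subseteq> set v" and B: "set B \<subseteq> set v"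
  shows "decide_links v es s t A B k m \<longleftrightarrow> (set A, set B) \<in> (links k m (set A) (set B))\<^sup>*"
proof -
  let ?L = "code v (set A) # code v (set B) #
    filter (\<lambda>S. length (elems S) \<le> k) (minsep_list v es s t)"
  have "set ?L = code v ` nodes k (set A) (set B)"
    by (auto simp: nodes_def set_minsep_list length_code is_minsepD(2))
  then have "arcs_of (link_list v m ?L) =
      map_prod (code v) (code v) ` links k m (set A) (set B)"
    unfolding links_def using nodes_subset[OF A B] by (rule arcs_of_link_list)
  then have "decide_links v es s t A B k m \<longleftrightarrow> (code v (set A), code v (set B)) \<in>
      (map_prod (code v) (code v) ` links k m (set A) (set B))\<^sup>*"
    by (simp add: decide_links_def)
  also have "\<dots> \<longleftrightarrow> (set A, set B) \<in> (links k m (set A) (set B))\<^sup>*"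
    by (rule rtrancl_map_prod_iff[OF inj_on_code links_subset[OF A B]]) (use A B in auto)
  finally show ?thesis .
qed

end

lemma ptime_minsep_list:
  assumes v: "ptime_list D v" and es: "ptime_list D es" and s: "ptime D s" and t: "ptime D t"
    and graph: "\<And>d. d \<in> D \<Longrightarrow> listed_graph (v d) (es d) (s d) (t d)"
    and M: "poly_bounded D M"
    and card: "\<And>d. d \<in> D \<Longrightarrow>
      card {S. st_graph.is_minsep (set (v d)) (arcs_of (es d)) (s d) (t d) S} \<le> M d"
  shows "ptime_list D (\<lambda>d. minsep_list (v d) (es d) (s d) (t d))"
  unfolding minsep_list_def
proof (rule ptime_list_funpow)
  show "ptime_list (right -` D)
      (\<lambda>p. next_round (v (right p)) (es (right p)) (t (right p)) (elems (left p)))"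
    by (intro ptime_next_round ptime_intros v es t)
  show "ptime_list D (\<lambda>d. first_round (v d) (es d) (s d) (t d))"
    unfolding first_round_def by (intro ptime_core_code ptime_nbr_list ptime_intros v es s t)
  show "poly_bounded D (\<lambda>d. M d * (size (dlist (v d)) + 1))"
    by (intro poly_bounded_intros poly_bounded_ptime M v)
  fix d i assume d: "d \<in> D"
  show "size (dlist ((next_round (v d) (es d) (t d) ^^ i) (first_round (v d) (es d) (s d) (t d))))
      \<le> M d * (size (dlist (v d)) + 1)"
    using listed_graph.size_next_round_funpow_le[OF graph[OF d], of i]
      mult_le_mono1[OF card[OF d], of "size (dlist (v d)) + 1"] by linarith
qed (intro ptime_intros v)


section \<open>Encoded instances\<close>

lemma nat_of_bits_enc_nat: "nat_of_bits (elems (enc_nat k)) = k"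
proof (induction k rule: less_induct)
  case (less k)
  show ?case
  proof (cases "k = 0")
    case True
    then show ?thesis by (simp add: enc_nat.simps[of 0] nat_of_bits_def)
  next
    case False
    then have "nat_of_bits (elems (enc_nat k)) = of_bool (odd k) + 2 * (k div 2)"
      using less.IH[of "k div 2"] by (simp add: enc_nat.simps[of k] nat_of_bits_def)
    then show ?thesis by (simp add: mod2_eq_if[symmetric])
  qed
qed

lemma inj_enc_nat: "inj enc_nat"
  by (rule inj_on_inverseI[where g = "\<lambda>d. nat_of_bits (elems d)"]) (rule nat_of_bits_enc_nat)

lemma dset_encodes_set: "encodes_set f A d \<Longrightarrow> dset d = f ` A"
  by (auto simp: encodes_set_def)

lemma length_encodes_set: "encodes_set f A d \<Longrightarrow> length (elems d) = card A"
  by (auto simp: encodes_set_def distinct_card)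

locale encoded_graph = nonadjacent_pair G s t for G :: "nat pair_pre_digraph" and s t +
  fixes g :: data
  assumes encodes_graph: "encodes_graph G g"
begin

sublocale st_graph_image "pverts G" "parcs G" s t enc_nat
  by unfold_locales (rule inj_enc_nat)

lemma encodes_pverts: "encodes_set enc_nat (pverts G) (left g)"
  and encodes_parcs: "encodes_set enc_arc (parcs G) (right g)"
  using encodes_graph by (auto simp: encodes_graph_def)

lemma arcs_of_parcs: "arcs_of (elems (right g)) = map_prod enc_nat enc_nat ` parcs G"
  unfolding arcs_of_def dset_encodes_set[OF encodes_parcs] image_image enc_arc_def
  by (simp add: map_prod_def case_prod_beta)

lemma listed_graph:
  "listed_graph (elems (left g)) (elems (right g)) (enc_nat s) (enc_nat t)"
proof -
  have "distinct (elems (left g))"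
    using encodes_pverts inj_on_subset[OF inj_enc_nat subset_UNIV]
    by (auto simp: encodes_set_def distinct_map)
  then show ?thesis
    using img.st_graph_axioms
    by (simp add: listed_graph_def listed_graph_axioms_def arcs_of_parcs
        dset_encodes_set[OF encodes_pverts])
qed

lemma card_minseps_le:
  "card {S. st_graph.is_minsep (dset (left g)) (arcs_of (elems (right g)))
       (enc_nat s) (enc_nat t) S}
     \<le> card (minimal_vertex_separators G)"
  unfolding dset_encodes_set[OF encodes_pverts] arcs_of_parcs minseps_image
  by (meson card_image_le card_mono finite_minseps finite_minimal_vertex_separators minseps_subset
      order_trans)

lemma decide_links_iff:
  assumes A: "A \<subseteq> pverts G" "encodes_set enc_nat A a"
    and B: "B \<subseteq> pverts G" "encodes_set enc_nat B b"
  shows "decide_links (elems (left g)) (elems (right g)) (enc_nat s) (enc_nat t)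
      (elems a) (elems b) k m \<longleftrightarrow>
    (A, B) \<in> (links k m A B)\<^sup>*"
  using listed_graph.decide_links_iff[OF listed_graph, of "elems a" "elems b" k m] A(1) B(1)
  by (simp add: dset_encodes_set[OF A(2)] dset_encodes_set[OF B(2)]
      dset_encodes_set[OF encodes_pverts] arcs_of_parcs image_mono rtrancl_links_image_iff)

end

lemma encoded_graphI:
  assumes "pair_graph G" "nonadjacent G s t" "encodes_tj (G, s, t, A, B) d"
  shows "encoded_graph G s t (left d)"
  using assms by (intro encoded_graph.intro encoded_graph_axioms.intro nonadjacent_pairI) auto

abbreviation inst_verts :: "data \<Rightarrow> data list" where
  "inst_verts d \<equiv> elems (left (left d))"

abbreviation inst_arcs :: "data \<Rightarrow> data list" where
  "inst_arcs d \<equiv> elems (right (left d))"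

abbreviation inst_s :: "data \<Rightarrow> data" where
  "inst_s d \<equiv> left (right d)"

abbreviation inst_t :: "data \<Rightarrow> data" where
  "inst_t d \<equiv> left (right (right d))"

abbreviation inst_source :: "data \<Rightarrow> data list" where
  "inst_source d \<equiv> elems (left (right (right (right d))))"

abbreviation inst_target :: "data \<Rightarrow> data list" where
  "inst_target d \<equiv> elems (right (right (right (right d))))"

definition decide_encoded_links :: "data \<Rightarrow> nat \<Rightarrow> nat \<Rightarrow> bool" where
  "decide_encoded_links d k m = decide_links (inst_verts d) (inst_arcs d) (inst_s d) (inst_t d)
     (inst_source d) (inst_target d) k m"

lemma decide_encoded_links_iff:
  assumes "pair_graph G" "nonadjacent G s t" "separator G s t A" "separator G s t B"
    and "encodes_tj (G, s, t, A, B) d"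
  shows "decide_encoded_links d k m \<longleftrightarrow>
    (A, B) \<in> (st_graph.links (pverts G) (parcs G) s t k m A B)\<^sup>*"
proof -
  interpret encoded_graph G s t "left d"
    by (rule encoded_graphI[OF assms(1,2,5)])
  have "A \<subseteq> pverts G" "B \<subseteq> pverts G" using assms(3,4) by (auto simp: separator_def)
  then show ?thesis
    using assms(5) decide_links_iff[of A _ B _ k m] by (auto simp: decide_encoded_links_def)
qed

lemma real_poly_le_nat_poly: "\<exists>q :: nat poly. \<forall>n. poly p (real n) \<le> real (poly q n)"
proof (induction p)
  case 0
  show ?case by (intro exI[of _ 0]) simp
next
  case (pCons a p)
  then obtain q :: "nat poly" where q: "\<And>n. poly p (real n) \<le> real (poly q n)" by blast
  have "poly (pCons a p) (real n) \<le> real (poly (pCons (nat \<lceil>a\<rceil>) q) n)" for n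
    using q[of n] real_nat_ceiling_ge[of a] by (auto intro!: add_mono mult_left_mono)
  then show ?case by blast
qed

locale few_minimal_separators =
  fixes \<G> :: "nat pair_pre_digraph set" and p :: "real poly"
  assumes pair_graph: "G \<in> \<G> \<Longrightarrow> pair_graph G"
    and card_minimal_vertex_separators_le:
      "G \<in> \<G> \<Longrightarrow> real (card (minimal_vertex_separators G)) \<le> poly p (real (card (pverts G)))"
begin

lemma ex_poly_minimal_vertex_separators_le:
  "\<exists>q. \<forall>G \<in> \<G>. \<forall>g. encodes_graph G g \<longrightarrow>
    card (minimal_vertex_separators G) \<le> poly q (size g)"
proof -
  obtain q :: "nat poly" where q: "\<And>n. poly p (real n) \<le> real (poly q n)"
    using real_poly_le_nat_poly by blast
  have "card (minimal_vertex_separators G) \<le> poly q (size g)"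
    if G: "G \<in> \<G>" and g: "encodes_graph G g" for G g
  proof -
    have "encodes_set enc_nat (pverts G) (left g)" using g by (auto simp: encodes_graph_def)
    from length_encodes_set[OF this] have "card (pverts G) \<le> size (left g)"
      using length_le_size_dlist[of "elems (left g)"] by simp
    then have "card (pverts G) \<le> size g" using size_left_le order_trans by blast
    moreover have "card (minimal_vertex_separators G) \<le> poly q (card (pverts G))"
      using card_minimal_vertex_separators_le[OF G] q of_nat_le_iff order_trans by blast
    ultimately show ?thesis using poly_nat_mono order_trans by blast
  qed
  then show ?thesis by blast
qed

lemma ptime_decide_encoded_links:
  assumes f: "ptime D f" and k: "ptime_nat D k" and m: "ptime_nat D m"
    and D: "\<And>d. d \<in> D \<Longrightarrow>
      \<exists>G s t A B. G \<in> \<G> \<and> nonadjacent G s t \<and> encodes_tj (G, s, t, A, B) (f d)"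
  shows "ptime_pred D (\<lambda>d. decide_encoded_links (f d) (k d) (m d))"
proof -
  obtain q where q: "\<And>G g. G \<in> \<G> \<Longrightarrow> encodes_graph G g \<Longrightarrow>
      card (minimal_vertex_separators G) \<le> poly q (size g)"
    using ex_poly_minimal_vertex_separators_le by blast
  have "ptime_list D (\<lambda>d. minsep_list (inst_verts (f d)) (inst_arcs (f d))
      (inst_s (f d)) (inst_t (f d)))"
  proof (rule ptime_minsep_list)
    show "poly_bounded D (\<lambda>d. poly q (size (left (f d))))"
      by (intro poly_bounded_poly poly_bounded_ptime ptime_left f)
    fix d assume "d \<in> D"
    then obtain G s t A B where G: "G \<in> \<G>" "nonadjacent G s t" "encodes_tj (G, s, t, A, B) (f d)"
      using D by blast
    then have st: "inst_s (f d) = enc_nat s" "inst_t (f d) = enc_nat t" by auto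
    interpret encoded_graph G s t "left (f d)"
      by (rule encoded_graphI[OF pair_graph[OF G(1)] G(2,3)])
    show "listed_graph (inst_verts (f d)) (inst_arcs (f d)) (inst_s (f d)) (inst_t (f d))"
      unfolding st by (rule listed_graph)
    show "card {S. st_graph.is_minsep (set (inst_verts (f d))) (arcs_of (inst_arcs (f d)))
        (inst_s (f d)) (inst_t (f d)) S} \<le> poly q (size (left (f d)))"
      unfolding st using card_minseps_le q[OF G(1) encodes_graph] by (rule order_trans)
  qed (intro ptime_intros f)+
  then show ?thesis
    unfolding decide_encoded_links_def by (rule ptime_decide_links) (intro ptime_intros f k m)+
qed

theorem tj_poly_time_solvable: "poly_time_solvable (tj_instances \<G>) encodes_tj tj_yes"
proof (rule poly_time_solvableI)
  let ?card = "\<lambda>d. length (inst_source d)"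
  show "ptime_pred {d. \<exists>i \<in> tj_instances \<G>. encodes_tj i d}
      (\<lambda>d. decide_encoded_links d (?card d) (Suc (?card d)))"
  proof (rule ptime_decide_encoded_links)
    show "\<exists>G s t A B. G \<in> \<G> \<and> nonadjacent G s t \<and> encodes_tj (G, s, t, A, B) d"
      if "d \<in> {d. \<exists>i \<in> tj_instances \<G>. encodes_tj i d}" for d
      using that unfolding tj_instances_def by blast
  qed (intro ptime_intros)+
  fix i d assume i: "i \<in> tj_instances \<G>" and d: "encodes_tj i d"
  obtain G s t A B where i_eq: "i = (G, s, t, A, B)" by (cases i)
  have G: "pair_graph G" "nonadjacent G s t" and sep: "separator G s t A" "separator G s t B"
    and card: "card A = card B"
    using i pair_graph by (auto simp: tj_instances_def i_eq)
  interpret nonadjacent_pair G s t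
    by (rule nonadjacent_pairI[OF G])
  have is_sep: "is_sep A" "is_sep B" using sep by (simp_all add: separator_eq_is_sep)
  have "?card d = card A" using d length_encodes_set by (auto simp: i_eq)
  then have "decide_encoded_links d (?card d) (Suc (?card d)) \<longleftrightarrow>
      (A, B) \<in> (links (card A) (card A + 1) A B)\<^sup>*"
    using decide_encoded_links_iff[OF G sep] d by (simp add: i_eq)
  also have "\<dots> \<longleftrightarrow> tj_yes i"
    using tj_iff_links[OF is_sep(1) refl is_sep(2) card[symmetric]] is_sep(1)
    by (simp add: i_eq reconfigurable_iff_sep_step)
  finally show "dbool (decide_encoded_links d (?card d) (Suc (?card d))) \<noteq> Atom \<longleftrightarrow> tj_yes i"
    by simp
qed

theorem tar_poly_time_solvable: "poly_time_solvable (tar_instances \<G>) encodes_tar tar_yes"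
proof (rule poly_time_solvableI)
  let ?k = "\<lambda>d. min (nat_of_bits (elems (left d))) (length (inst_verts (right d)))"
  show "ptime_pred {d. \<exists>i \<in> tar_instances \<G>. encodes_tar i d}
      (\<lambda>d. decide_encoded_links (right d) (?k d) (?k d))"
  proof (rule ptime_decide_encoded_links)
    show "\<exists>G s t A B. G \<in> \<G> \<and> nonadjacent G s t \<and> encodes_tj (G, s, t, A, B) (right d)"
      if "d \<in> {d. \<exists>i \<in> tar_instances \<G>. encodes_tar i d}" for d
      using that unfolding tar_instances_def by fastforce
  qed (intro ptime_nat_min_nat_of_bits ptime_intros)+
  fix i d assume i: "i \<in> tar_instances \<G>" and d: "encodes_tar i d"
  obtain G s t A B k where i_eq: "i = (G, s, t, A, B, k)" by (cases i)
  have G: "pair_graph G" "nonadjacent G s t" and sep: "separator G s t A" "separator G s t B"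
    and card: "card A \<le> k" "card B \<le> k"
    using i pair_graph by (auto simp: tar_instances_def i_eq)
  interpret nonadjacent_pair G s t
    by (rule nonadjacent_pairI[OF G])
  have is_sep: "is_sep A" "is_sep B" using sep by (simp_all add: separator_eq_is_sep)
  have d': "encodes_tj (G, s, t, A, B) (right d)" "left d = enc_nat k"
    using d by (auto simp: i_eq)
  then have "encodes_set enc_nat (pverts G) (left (left (right d)))"
    by (auto simp: encodes_graph_def)
  from length_encodes_set[OF this] have "?k d = min k (card (pverts G))"
    by (simp add: d'(2) nat_of_bits_enc_nat)
  then have "decide_encoded_links (right d) (?k d) (?k d) \<longleftrightarrow>
      (A, B) \<in> (links (min k (card (pverts G))) (min k (card (pverts G))) A B)\<^sup>*"
    using decide_encoded_links_iff[OF G sep d'(1)] by simp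
  also have "\<dots> \<longleftrightarrow> (A, B) \<in> (links k k A B)\<^sup>*"
    using sep by (simp add: links_min_card separator_def subset_iff)
  also have "\<dots> \<longleftrightarrow> tar_yes i"
    using tar_iff_links[OF is_sep(1) card(1) is_sep(2) card(2)] is_sep(1)
    by (simp add: i_eq reconfigurable_iff_sep_step)
  finally show "dbool (decide_encoded_links (right d) (?k d) (?k d)) \<noteq> Atom \<longleftrightarrow> tar_yes i" by simp
qed

end

theorem theorem3:
  fixes \<G> :: "nat pair_pre_digraph set"
  assumes "\<And>G. G \<in> \<G> \<Longrightarrow> pair_graph G"
    and "\<exists>p :: real poly. \<forall>G \<in> \<G>.
           real (card (minimal_vertex_separators G)) \<le> poly p (real (card (pverts G)))"
  shows "poly_time_solvable (tar_instances \<G>) encodes_tar tar_yes \<and>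
         poly_time_solvable (tj_instances \<G>) encodes_tj tj_yes"
proof -
  obtain p :: "real poly" where "few_minimal_separators \<G> p"
    using assms unfolding few_minimal_separators_def by blast
  then interpret few_minimal_separators \<G> p .
  show ?thesis using tar_poly_time_solvable tj_poly_time_solvable by blast
qed

end
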